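(* Let $n \geq 3$ be an integer, let $S=\{0,s,t\}\subseteq\mathbb{Z}_n$ with $s,t\in\mathbb{Z}_n^*$ and $t\neq\pm s$, and set $d=\gcd(n,s-t)$. Let $$U_S(\mathbb{Z}_n)=\{k\in\mathbb{Z}_n^* \mid k\,\mathrm{End}(\mathrm{Cay}(\mathbb{Z}_n,S))\,k^{-1}=\mathrm{End}(\mathrm{Cay}(\mathbb{Z}_n,S))\}.$$ The following statements hold: (a) If $2d<n$ and the equation $xs+(d-x)t\equiv 0\pmod n$ has an integer solution $x$ with $1\leq x\leq d-1$, then $$U_S(\mathbb{Z}_n)=\begin{cases}\{\pm1,\pm ts^{-1}\}, & \text{if } t^2\equiv s^2\pmod n,\\ \{\pm1\}, & \text{if } t^2\not\equiv s^2\pmod n.\end{cases}$$ (b) Otherwise, $U_S(\mathbb{Z}_n)=\mathbb{Z}_n^*$.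
   Context: $\mathbb{Z}_n$ is the ring of integers modulo $n$ and $\mathbb{Z}_n^*$ its group of units. A digraph $G=(V,A)$ has a non-empty vertex set $V$ and arc set $A\subseteq V\times V$ (loops are allowed). For $S\subseteq\mathbb{Z}_n$, $\mathrm{Cay}(\mathbb{Z}_n,S)$ is the digraph with vertex set $\mathbb{Z}_n$ and arc set $\{(i,j)\in\mathbb{Z}_n\times\mathbb{Z}_n \mid j-i\in S\}$. An endomorphism of a digraph $G$ is a map $V(G)\to V(G)$ sending arcs to arcs; $\mathrm{End}(G)$ is the monoid of all endomorphisms under composition. Each $k\in\mathbb{Z}_n^*$ is identified with the bijection $x\mapsto kx$ of $\mathbb{Z}_n$, so $k\,\mathrm{End}(G)\,k^{-1}$ is the set of maps $x\mapsto k f(k^{-1}x)$ with $f\in\mathrm{End}(G)$. In $\gcd(n,s-t)$, $s-t$ is represented by any integer in its residue class; the inverse $s^{-1}$ is taken in $\mathbb{Z}_n^*$. *)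

theory Defs
  imports "HOL-Number_Theory.Residues" "HOL-Library.FuncSet" "Graph_Theory.Pair_Digraph"
begin

definition Cay :: "('a, 'm) ring_scheme \<Rightarrow> 'a set \<Rightarrow> 'a pair_pre_digraph" where
  "Cay R S = \<lparr>pverts = carrier R,
    parcs = {(i, j). i \<in> carrier R \<and> j \<in> carrier R \<and> j \<ominus>\<^bsub>R\<^esub> i \<in> S}\<rparr>"

(* Endomorphisms are extensional, so that equality in End G is equality of maps on the
   vertex set. *)
definition End :: "'a pair_pre_digraph \<Rightarrow> ('a \<Rightarrow> 'a) monoid" where
  "End G = \<lparr>
    carrier = {f \<in> pverts G \<rightarrow>\<^sub>E pverts G. \<forall>(u, v) \<in> parcs G. (f u, f v) \<in> parcs G},
    monoid.mult = compose (pverts G),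
    one = (\<lambda>x\<in>pverts G. x)\<rparr>"

definition unit_conj :: "('a, 'm) ring_scheme \<Rightarrow> 'a \<Rightarrow> ('a \<Rightarrow> 'a) set \<Rightarrow> ('a \<Rightarrow> 'a) set" where
  "unit_conj R k F =
    (\<lambda>f. \<lambda>x\<in>carrier R. k \<otimes>\<^bsub>R\<^esub> f (inv\<^bsub>R\<^esub> k \<otimes>\<^bsub>R\<^esub> x)) ` F"

definition U :: "('a, 'm) ring_scheme \<Rightarrow> 'a set \<Rightarrow> 'a set" where
  "U R S = {k \<in> Units R. unit_conj R k (carrier (End (Cay R S))) = carrier (End (Cay R S))}"

lemma pair_wf_digraph_Cay: "pair_wf_digraph (Cay R S)"
  by unfold_locales (auto simp: Cay_def)

lemma monoid_End:
  assumes "pair_wf_digraph G"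
  shows "monoid (End G)"
proof -
  interpret pair_wf_digraph G by (rule assms)
  let ?V = "pverts G"
  have mem: "f \<in> carrier (End G) \<longleftrightarrow>
      f \<in> ?V \<rightarrow>\<^sub>E ?V \<and> (\<forall>u v. (u, v) \<in> parcs G \<longrightarrow> (f u, f v) \<in> parcs G)" for f
    by (auto simp: End_def)
  have mult: "f \<otimes>\<^bsub>End G\<^esub> g = compose ?V f g" and one: "\<one>\<^bsub>End G\<^esub> = (\<lambda>x\<in>?V. x)" for f g
    by (simp_all add: End_def)
  show ?thesis
  proof (rule monoidI)
    fix f g assume "f \<in> carrier (End G)" "g \<in> carrier (End G)"
    then show "f \<otimes>\<^bsub>End G\<^esub> g \<in> carrier (End G)"
      unfolding mem mult by (auto simp: compose_def dest: in_arcsD1 in_arcsD2)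
  next
    show "\<one>\<^bsub>End G\<^esub> \<in> carrier (End G)"
      unfolding mem one by (auto dest: in_arcsD1 in_arcsD2)
  next
    fix f g h
    assume "f \<in> carrier (End G)" "g \<in> carrier (End G)" "h \<in> carrier (End G)"
    then have "h \<in> ?V \<rightarrow> ?V" by (auto simp: mem)
    then show "f \<otimes>\<^bsub>End G\<^esub> g \<otimes>\<^bsub>End G\<^esub> h = f \<otimes>\<^bsub>End G\<^esub> (g \<otimes>\<^bsub>End G\<^esub> h)"
      unfolding mult by (rule compose_assoc[symmetric])
  next
    fix f assume "f \<in> carrier (End G)"
    then have "f \<in> ?V \<rightarrow> ?V" "f \<in> extensional ?V" by (auto simp: mem PiE_def)
    then show "\<one>\<^bsub>End G\<^esub> \<otimes>\<^bsub>End G\<^esub> f = f" and "f \<otimes>\<^bsub>End G\<^esub> \<one>\<^bsub>End G\<^esub> = f"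
      unfolding mult one by (rule Id_compose, rule compose_Id)
  qed
qed

end

theory Submission
  imports Defs
begin

text \<open>
  Write \<open>r\<close> for \<open>t / s\<close> modulo \<open>n\<close>. Conjugation by a unit \<open>k\<close> carries the endomorphisms of
  \<open>Cay(S)\<close> to those of \<open>Cay(k S)\<close>, and conjugations by different units commute. Dividing by \<open>s\<close>
  therefore changes neither side of the claim, and one may take \<open>S = {0, 1, r}\<close> and
  \<open>d = gcd n (1 - r)\<close>. The equation then asks for positive \<open>x\<close>, \<open>y\<close> with \<open>x + y = d\<close> and
  \<open>x + y r \<equiv> 0\<close>: a closed walk of length \<open>d\<close> with steps \<open>1\<close> and \<open>r\<close>.
  
  Conjugating an affine map by \<open>k\<close> only changes its constant term, and translations are
  automorphisms. So if every endomorphism is affine, then every unit stabilises the monoid, and the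
  theorem comes down to the non-affine endomorphisms \<open>h\<close>. Suppose that the six sums of two elements
  of \<open>S\<close> are distinct modulo \<open>n\<close>. Then the two paths from \<open>i\<close> to \<open>i + 1 + r\<close> see the same multiset of
  increments of \<open>h\<close>. Hence counting the increments \<open>1\<close> and \<open>r\<close> along paths gives a linear
  map \<open>A\<close> on the lattice \<open>L = {(p, q). p + q r \<equiv> 0}\<close>: a closed path with \<open>p\<close> steps \<open>1\<close> and \<open>q\<close> steps \<open>r\<close> is
  sent to a closed path with \<open>A (p, q)\<close> such steps. The matrix of \<open>A\<close> has non-negative entries and
  column sums at most \<open>1\<close>, and \<open>A\<close> maps \<open>L\<close> to itself, so its trace and determinant are integers.
  Such matrices are rare (\<open>contraction_cases\<close>): either some step always has the same increment, and
  then \<open>h\<close> is affine, or both columns of \<open>A\<close> are \<open>(a, 1 - a)\<close>. In the latter case a vector of \<open>L\<close> with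
  coordinate sum \<open>d\<close> is sent to \<open>(d a, d (1 - a))\<close>, which solves the equation
  (\<open>affine_or_closed_walk\<close>). Two of the six sums coincide only for \<open>r = 2\<close> or \<open>2 r \<equiv> 1\<close>, where all
  endomorphisms are affine by a winding number argument (\<open>affine_map_of_hom_1_2\<close>), and for
  \<open>2 d = n\<close>, where the non-constant endomorphisms are the maps congruent to a translation modulo \<open>d\<close>
  (\<open>constant_or_translation_mod_half\<close>); that class is again closed under conjugation.
  
  Conversely, let \<open>2 d < n\<close> and let \<open>(x, y)\<close> be a solution. Since \<open>r \<equiv> 1\<close> modulo \<open>d\<close>, reducing modulo \<open>d\<close>
  and then running along a closed walk with \<open>x\<close> steps \<open>1\<close> and \<open>y\<close> steps \<open>r\<close>, in any order, is an
  endomorphism. If \<open>k\<close> stabilises the monoid and \<open>l\<close> is the inverse of \<open>k\<close> modulo \<open>d\<close>, then \<open>k\<close> times the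
  sum of any \<open>l\<close> consecutive steps must be \<open>1\<close> or \<open>r\<close>. Reordering the steps yields at least three
  different sums, unless \<open>l\<close> is \<open>1\<close> or \<open>d - 1\<close> or one kind of step occurs only once; the last exception
  is removed by passing to another solution. For \<open>l = 1\<close> and \<open>l = d - 1\<close> the condition says that \<open>k\<close>
  or \<open>-k\<close> permutes \<open>{1, r}\<close> (\<open>stabilising_unit_cases\<close>).
\<close>

section \<open>Endomorphisms as periodic functions on the integers\<close>

text \<open>
  Residue classes are replaced by integers, so that steps such as \<open>1\<close>, \<open>2\<close> or \<open>-s\<close> and the
  arithmetic on them are those of \<open>int\<close>. Arcs of step \<open>0\<close> are loops and are preserved by every map,
  so only the steps \<open>s\<close> and \<open>t\<close> appear as sources.
\<close>

definition cay_hom :: "int \<Rightarrow> int \<Rightarrow> int \<Rightarrow> (int \<Rightarrow> int) \<Rightarrow> bool" where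
  "cay_hom n s t h \<longleftrightarrow>
     (\<forall>i j. [i = j] (mod n) \<longrightarrow> [h i = h j] (mod n)) \<and>
     (\<forall>i. \<forall>c\<in>{s, t}. \<exists>e\<in>{0, s, t}. [h (i + c) - h i = e] (mod n))"

text \<open>
  Conjugation by \<open>k\<close>, where \<open>k'\<close> is any integer representing the inverse of \<open>k\<close>.
\<close>

definition dilate :: "int \<Rightarrow> int \<Rightarrow> (int \<Rightarrow> int) \<Rightarrow> int \<Rightarrow> int" where
  "dilate k k' h = (\<lambda>i. k * h (k' * i))"

text \<open>
  One inclusion suffices: conjugation is injective on the finite set of endomorphisms.
\<close>

definition stabilises :: "int \<Rightarrow> int \<Rightarrow> int \<Rightarrow> int \<Rightarrow> int \<Rightarrow> bool" where
  "stabilises n s t k k' \<longleftrightarrow> (\<forall>h. cay_hom n s t h \<longrightarrow> cay_hom n s t (dilate k k' h))"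

lemma cay_hom_periodic:
  "cay_hom n s t h \<Longrightarrow> [i = j] (mod n) \<Longrightarrow> [h i = h j] (mod n)"
  by (simp add: cay_hom_def)

lemma cay_hom_step:
  assumes "cay_hom n s t h" "c \<in> {s, t}"
  shows "\<exists>e\<in>{0, s, t}. [h (i + c) - h i = e] (mod n)"
  using assms unfolding cay_hom_def by blast

lemma cay_hom_cong_fun:
  assumes "cay_hom n s t h" "\<And>i. [h i = h' i] (mod n)"
  shows "cay_hom n s t h'"
  unfolding cay_hom_def
proof (intro conjI allI ballI impI)
  show "[h' i = h' j] (mod n)" if "[i = j] (mod n)" for i j
    using cay_hom_periodic[OF assms(1) that] assms(2)[of i] assms(2)[of j]
    by (meson cong_sym cong_trans)
next
  fix i c assume c: "c \<in> {s, t}"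
  obtain e where e: "e \<in> {0, s, t}" "[h (i + c) - h i = e] (mod n)"
    using cay_hom_step[OF assms(1) c] by blast
  moreover have "[h' (i + c) - h' i = h (i + c) - h i] (mod n)"
    by (intro cong_diff cong_sym[OF assms(2)])
  ultimately show "\<exists>e\<in>{0, s, t}. [h' (i + c) - h' i = e] (mod n)"
    using cong_trans by blast
qed

lemma cay_hom_cong_steps:
  assumes h: "cay_hom n s t h" and st: "[s = s'] (mod n)" "[t = t'] (mod n)"
  shows "cay_hom n s' t' h"
  unfolding cay_hom_def
proof (intro conjI allI ballI impI)
  show "[h i = h j] (mod n)" if "[i = j] (mod n)" for i j
    using h that by (rule cay_hom_periodic)
next
  fix i c' assume "c' \<in> {s', t'}"
  then obtain c where c: "c \<in> {s, t}" "[c = c'] (mod n)"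
    using st by (elim insertE) auto
  obtain e where e: "e \<in> {0, s, t}" "[h (i + c) - h i = e] (mod n)"
    using cay_hom_step[OF h c(1)] by blast
  have "\<exists>e'\<in>{0, s', t'}. [e = e'] (mod n)"
    using st e(1) by (elim insertE) auto
  then obtain e' where e': "e' \<in> {0, s', t'}" "[e = e'] (mod n)" by blast
  have "[h (i + c') - h i = h (i + c) - h i] (mod n)"
    by (intro cong_diff cay_hom_periodic[OF h] cong_add cong_sym[OF c(2)]) auto
  then have "[h (i + c') - h i = e'] (mod n)"
    by (rule cong_trans[OF _ cong_trans[OF e(2) e'(2)]])
  with e'(1) show "\<exists>e\<in>{0, s', t'}. [h (i + c') - h i = e] (mod n)" by (rule bexI[rotated])
qed

lemma cay_hom_swap: "cay_hom n s t h \<Longrightarrow> cay_hom n t s h"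
  unfolding cay_hom_def by (auto simp: insert_commute)

lemma cay_hom_uminus:
  assumes h: "cay_hom n s t h"
  shows "cay_hom n (-s) (-t) h"
  unfolding cay_hom_def
proof (intro conjI allI ballI impI)
  show "[h i = h j] (mod n)" if "[i = j] (mod n)" for i j
    using h that by (rule cay_hom_periodic)
next
  fix i c assume "c \<in> {-s, -t}"
  then have "-c \<in> {s, t}" by auto
  from cay_hom_step[OF h this, of "i + c"] obtain e
    where e: "e \<in> {0, s, t}" "[h i - h (i + c) = e] (mod n)" by auto
  then have "[h (i + c) - h i = - e] (mod n)"
    using cong_uminus by fastforce
  moreover have "-e \<in> {0, -s, -t}" using e by auto
  ultimately show "\<exists>e\<in>{0, -s, -t}. [h (i + c) - h i = e] (mod n)" by blast
qed

text \<open>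
  An arc of step \<open>k c\<close> from \<open>i\<close> is seen by \<open>h\<close> as an arc of step \<open>c\<close> from \<open>k' i\<close>.
\<close>

lemma cay_hom_dilate:
  assumes h: "cay_hom n s t h" and k: "[k * k' = 1] (mod n)"
  shows "cay_hom n (k * s) (k * t) (dilate k k' h)"
  unfolding cay_hom_def
proof (intro conjI allI ballI impI)
  fix i j assume "[i = j] (mod n)"
  then show "[dilate k k' h i = dilate k k' h j] (mod n)"
    unfolding dilate_def by (intro cong_scalar_left cay_hom_periodic[OF h])
next
  fix i c' assume "c' \<in> {k * s, k * t}"
  then obtain c where c: "c \<in> {s, t}" "c' = k * c" by blast
  obtain e where e: "e \<in> {0, s, t}" "[h (k' * i + c) - h (k' * i) = e] (mod n)"
    using cay_hom_step[OF h c(1)] by blast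
  have "[(k * k') * c = 1 * c] (mod n)" using k by (rule cong_scalar_right)
  then have "[k' * (i + c') = k' * i + c] (mod n)"
    unfolding c(2) cong_iff_dvd_diff by (simp add: algebra_simps)
  then have "[h (k' * (i + c')) - h (k' * i) = h (k' * i + c) - h (k' * i)] (mod n)"
    by (intro cong_diff cay_hom_periodic[OF h]) auto
  then have "[k * (h (k' * (i + c')) - h (k' * i)) = k * e] (mod n)"
    using cong_scalar_left[OF e(2), of k] cong_scalar_left cong_trans by meson
  moreover have "k * e \<in> {0, k * s, k * t}" using e(1) by auto
  ultimately show "\<exists>e\<in>{0, k * s, k * t}. [dilate k k' h (i + c') - dilate k k' h i = e] (mod n)"
    unfolding dilate_def by (auto simp: right_diff_distrib)
qed

lemma dilate_inverse:
  assumes "cay_hom n s t h" "[k * k' = 1] (mod n)"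
  shows "[dilate k k' (dilate k' k h) i = h i] (mod n)"
proof -
  have 1: "[k * k' * x = x] (mod n)" for x
    using cong_scalar_right[OF assms(2), of x] by simp
  have "dilate k k' (dilate k' k h) i = k * k' * h (k * k' * i)"
    by (simp add: dilate_def mult.assoc)
  also have "[\<dots> = h (k * k' * i)] (mod n)" by (rule 1)
  also have "[h (k * k' * i) = h i] (mod n)"
    by (rule cay_hom_periodic[OF assms(1) 1])
  finally show ?thesis .
qed

lemma dilate_commute: "dilate k k' (dilate c c' h) = dilate c c' (dilate k k' h)"
  by (simp add: dilate_def fun_eq_iff ac_simps)

lemma stabilises_cong_steps:
  assumes "[s = s'] (mod n)" "[t = t'] (mod n)"
  shows "stabilises n s t k k' \<longleftrightarrow> stabilises n s' t' k k'"
proof -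
  have "cay_hom n s t h \<longleftrightarrow> cay_hom n s' t' h" for h
    using cay_hom_cong_steps[OF _ assms] cay_hom_cong_steps[OF _ assms[THEN cong_sym]] by blast
  then show ?thesis by (simp add: stabilises_def)
qed

text \<open>
  Conjugation by \<open>c\<close> transports the problem from \<open>{0, s, t}\<close> to \<open>{0, c s, c t}\<close>, and it commutes with
  conjugation by \<open>k\<close>.
\<close>

lemma stabilises_rescale:
  assumes st: "stabilises n s t k k'" and c: "[c * c' = 1] (mod n)"
  shows "stabilises n (c * s) (c * t) k k'"
  unfolding stabilises_def
proof (intro allI impI)
  fix h assume h: "cay_hom n (c * s) (c * t) h"
  have c': "[c' * c = 1] (mod n)" using c by (simp add: mult.commute)
  have 1: "[c' * (c * x) = x] (mod n)" for x
    using cong_scalar_right[OF c', of x] by (simp add: mult.assoc)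
  have "cay_hom n s t (dilate c' c h)"
    using cay_hom_cong_steps[OF cay_hom_dilate[OF h c']] 1 by blast
  then have "cay_hom n s t (dilate k k' (dilate c' c h))"
    using st by (simp add: stabilises_def)
  then have "cay_hom n s t (dilate c' c (dilate k k' h))"
    by (simp only: dilate_commute)
  then have *: "cay_hom n (c * s) (c * t) (dilate c c' (dilate c' c (dilate k k' h)))"
    by (rule cay_hom_dilate[OF _ c])
  have "[dilate c c' (dilate c' c (dilate k k' h)) i = dilate k k' h i] (mod n)" for i
  proof -
    have "[c * c' * x = x] (mod n)" for x
      using cong_scalar_right[OF c, of x] by simp
    note 2 = this
    have "dilate c c' (dilate c' c (dilate k k' h)) i = c * c' * (k * h (c * c' * (k' * i)))"
      by (simp add: dilate_def ac_simps)
    also have "[\<dots> = k * h (c * c' * (k' * i))] (mod n)" by (rule 2)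
    also have "[k * h (c * c' * (k' * i)) = k * h (k' * i)] (mod n)"
      by (intro cong_scalar_left cay_hom_periodic[OF h] 2)
    finally show ?thesis by (simp add: dilate_def)
  qed
  then show "cay_hom n (c * s) (c * t) (dilate k k' h)"
    using cay_hom_cong_fun[OF *] by blast
qed

lemma stabilises_rescale_iff:
  assumes c: "[c * c' = 1] (mod n)"
  shows "stabilises n (c * s) (c * t) k k' \<longleftrightarrow> stabilises n s t k k'"
proof
  assume "stabilises n s t k k'"
  then show "stabilises n (c * s) (c * t) k k'" using c by (rule stabilises_rescale)
next
  have c': "[c' * c = 1] (mod n)" using c by (simp add: mult.commute)
  have 1: "[c' * (c * x) = x] (mod n)" for x
    using cong_scalar_right[OF c', of x] by (simp add: mult.assoc)
  assume "stabilises n (c * s) (c * t) k k'"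
  from stabilises_rescale[OF this c'] have "stabilises n (c' * (c * s)) (c' * (c * t)) k k'" .
  then show "stabilises n s t k k'"
    by (rule stabilises_cong_steps[THEN iffD1, OF 1 1])
qed

section \<open>The stabiliser in terms of periodic functions\<close>

context residues
begin

lemma mem_Cay_arcs_iff:
  assumes "s \<in> carrier R" "t \<in> carrier R"
  shows "(i, j) \<in> parcs (Cay R {\<zero>, s, t}) \<longleftrightarrow>
    i \<in> carrier R \<and> j \<in> carrier R \<and> (\<exists>e\<in>{0, s, t}. [j - i = e] (mod m))"
proof -
  have "j \<ominus> i = (j - i) mod m"
    by (simp add: a_minus_def res_add_eq res_neg_eq mod_add_right_eq)
  moreover have "(j - i) mod m = e \<longleftrightarrow> [j - i = e] (mod m)" if "e \<in> {0, s, t}" for e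
    using that assms m_gt_one by (auto simp: cong_def res_carrier_eq)
  ultimately show ?thesis by (auto simp: Cay_def res_zero_eq)
qed

lemma mem_End_Cay_iff:
  assumes st: "s \<in> carrier R" "t \<in> carrier R"
  shows "f \<in> carrier (End (Cay R {\<zero>, s, t})) \<longleftrightarrow>
    f \<in> carrier R \<rightarrow>\<^sub>E carrier R \<and> cay_hom m s t (\<lambda>i. f (i mod m))"
    (is "_ \<longleftrightarrow> ?maps \<and> ?hom")
proof -
  have End: "f \<in> carrier (End (Cay R {\<zero>, s, t})) \<longleftrightarrow> ?maps \<and>
      (\<forall>(u, v) \<in> parcs (Cay R {\<zero>, s, t}). (f u, f v) \<in> parcs (Cay R {\<zero>, s, t}))"
    by (auto simp: End_def Cay_def)
  have "(\<forall>(u, v) \<in> parcs (Cay R {\<zero>, s, t}). (f u, f v) \<in> parcs (Cay R {\<zero>, s, t})) \<longleftrightarrow> ?hom"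
    if maps: ?maps
  proof
    assume arcs: "\<forall>(u, v) \<in> parcs (Cay R {\<zero>, s, t}). (f u, f v) \<in> parcs (Cay R {\<zero>, s, t})"
    show ?hom
      unfolding cay_hom_def
    proof (intro conjI allI ballI impI)
      show "[f (i mod m) = f (j mod m)] (mod m)" if "[i = j] (mod m)" for i j
        using that by (simp add: cong_def)
    next
      fix i c assume c: "c \<in> {s, t}"
      have "[(i + c) mod m - i mod m = c] (mod m)"
        by (simp add: cong_def mod_diff_eq)
      then have "(i mod m, (i + c) mod m) \<in> parcs (Cay R {\<zero>, s, t})"
        using c by (auto simp: mem_Cay_arcs_iff st)
      then have "(f (i mod m), f ((i + c) mod m)) \<in> parcs (Cay R {\<zero>, s, t})"
        using arcs by blast
      then show "\<exists>e\<in>{0, s, t}. [f ((i + c) mod m) - f (i mod m) = e] (mod m)"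
        unfolding mem_Cay_arcs_iff[OF st] by blast
    qed
  next
    assume hom: ?hom
    have "(f u, f v) \<in> parcs (Cay R {\<zero>, s, t})"
      if uv: "(u, v) \<in> parcs (Cay R {\<zero>, s, t})" for u v
    proof -
      from uv have carr: "u \<in> carrier R" "v \<in> carrier R"
        unfolding mem_Cay_arcs_iff[OF st] by blast+
      obtain c where c: "c \<in> {0, s, t}" "[v - u = c] (mod m)"
        using uv unfolding mem_Cay_arcs_iff[OF st] by blast
      have mods: "u mod m = u" "v mod m = v"
        using carr by (simp_all add: res_carrier_eq)
      have "[u + (v - u) = u + c] (mod m)" using c(2) by (intro cong_add) auto
      then have v: "v = (u + c) mod m" using mods by (simp add: cong_def)
      have "\<exists>e\<in>{0, s, t}. [f v - f u = e] (mod m)"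
      proof (cases "c = 0")
        case True
        with v mods show ?thesis by simp
      next
        case False
        with c(1) have "c \<in> {s, t}" by simp
        from cay_hom_step[OF hom this, of u] show ?thesis
          by (simp only: mods v)
      qed
      moreover have "f u \<in> carrier R" "f v \<in> carrier R" using maps carr by auto
      ultimately show ?thesis unfolding mem_Cay_arcs_iff[OF st] by blast
    qed
    then show "\<forall>(u, v) \<in> parcs (Cay R {\<zero>, s, t}). (f u, f v) \<in> parcs (Cay R {\<zero>, s, t})"
      by blast
  qed
  with End show ?thesis by blast
qed

lemma inj_on_conj:
  assumes k: "k \<in> Units R"
  shows "inj_on (\<lambda>f. \<lambda>x\<in>carrier R. k \<otimes> f (inv k \<otimes> x)) (carrier R \<rightarrow>\<^sub>E carrier R)"
proof (rule inj_onI, rule extensionalityI[where A = "carrier R"])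
  fix f g x
  assume f: "f \<in> carrier R \<rightarrow>\<^sub>E carrier R" and g: "g \<in> carrier R \<rightarrow>\<^sub>E carrier R"
    and eq: "(\<lambda>x\<in>carrier R. k \<otimes> f (inv k \<otimes> x)) = (\<lambda>x\<in>carrier R. k \<otimes> g (inv k \<otimes> x))"
    and x: "x \<in> carrier R"
  have "k \<otimes> x \<in> carrier R" "inv k \<otimes> (k \<otimes> x) = x"
    using k x by (simp_all add: m_assoc[symmetric] Units_closed Units_l_inv)
  with fun_cong[OF eq, of "k \<otimes> x"] have "k \<otimes> f x = k \<otimes> g x" by simp
  moreover have "f x \<in> carrier R" "g x \<in> carrier R" using f g x by auto
  ultimately show "f x = g x" using k by simp
qed (auto simp: PiE_def)

lemma inv_cong:
  assumes "k \<in> Units R"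
  shows "[k * inv k = 1] (mod m)"
  using Units_r_inv[OF assms] m_gt_one by (simp add: res_mult_eq res_one_eq cong_def)

text \<open>
  Reduction modulo \<open>m\<close> and restriction to the carrier turn a periodic function into an extensional
  map, and composition with the reduction goes back; both intertwine the two forms of conjugation up
  to congruence.
\<close>

lemma mem_U_iff_stabilises:
  assumes st: "s \<in> carrier R" "t \<in> carrier R"
  shows "k \<in> U R {\<zero>, s, t} \<longleftrightarrow> k \<in> Units R \<and> stabilises m s t k (inv k)"
proof -
  define E where "E = carrier (End (Cay R {\<zero>, s, t}))"
  have E: "f \<in> E \<longleftrightarrow> f \<in> carrier R \<rightarrow>\<^sub>E carrier R \<and> cay_hom m s t (\<lambda>i. f (i mod m))" for f
    unfolding E_def by (rule mem_End_Cay_iff[OF st])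
  define conj where "conj f = (\<lambda>x\<in>carrier R. k \<otimes> f (inv k \<otimes> x))" for f
  have conj_eq: "unit_conj R k E = conj ` E"
    by (simp add: unit_conj_def conj_def)
  have conj_dilate: "[conj f (i mod m) = dilate k (inv k) (\<lambda>i. f (i mod m)) i] (mod m)" for f i
    by (simp add: conj_def res_mult_eq dilate_def cong_def mod_mult_right_eq)
  have "conj ` E = E \<longleftrightarrow> stabilises m s t k (inv k)" if k: "k \<in> Units R"
  proof
    assume eq: "conj ` E = E"
    show "stabilises m s t k (inv k)"
      unfolding stabilises_def
    proof (intro allI impI)
      fix h assume h: "cay_hom m s t h"
      define f where "f = (\<lambda>x\<in>carrier R. h x mod m)"
      have fh: "[h i = f (i mod m)] (mod m)" for i
        using cay_hom_periodic[OF h, of i "i mod m"] by (simp add: f_def cong_def)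
      have "cay_hom m s t (\<lambda>i. f (i mod m))"
        by (rule cay_hom_cong_fun[OF h fh])
      then have "f \<in> E" unfolding E by (simp add: f_def)
      then have "conj f \<in> E" using eq by blast
      then have hom: "cay_hom m s t (\<lambda>i. conj f (i mod m))" unfolding E by blast
      have "[conj f (i mod m) = dilate k (inv k) h i] (mod m)" for i
        unfolding dilate_def
        by (rule cong_trans[OF conj_dilate, unfolded dilate_def])
          (intro cong_scalar_left cong_sym[OF fh])
      with hom show "cay_hom m s t (dilate k (inv k) h)"
        by (rule cay_hom_cong_fun)
    qed
  next
    assume stab: "stabilises m s t k (inv k)"
    have sub: "conj ` E \<subseteq> E"
    proof (rule image_subsetI)
      fix f assume f: "f \<in> E"
      then have "cay_hom m s t (dilate k (inv k) (\<lambda>i. f (i mod m)))"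
        using stab unfolding E stabilises_def by blast
      then have "cay_hom m s t (\<lambda>i. conj f (i mod m))"
        by (rule cay_hom_cong_fun) (rule cong_sym[OF conj_dilate])
      moreover have "conj f \<in> carrier R \<rightarrow>\<^sub>E carrier R"
        using f k unfolding E conj_def by auto
      ultimately show "conj f \<in> E" unfolding E by blast
    qed
    have "E \<subseteq> carrier R \<rightarrow>\<^sub>E carrier R" using E by blast
    moreover have "finite (carrier R \<rightarrow>\<^sub>E carrier R)"
      by (intro finite_PiE) auto
    moreover have "inj_on conj (carrier R \<rightarrow>\<^sub>E carrier R)"
      unfolding conj_def by (rule inj_on_conj[OF k])
    ultimately show "conj ` E = E"
      using sub by (intro endo_inj_surj) (auto intro: finite_subset inj_on_subset)
  qed
  then show ?thesis
    unfolding U_def mem_Collect_eq E_def[symmetric] conj_eq by blast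
qed

end

section \<open>Affine maps\<close>

definition affine_map :: "int \<Rightarrow> (int \<Rightarrow> int) \<Rightarrow> bool" where
  "affine_map n h \<longleftrightarrow> (\<exists>m. \<forall>i. [h i = h 0 + m * i] (mod n))"

text \<open>
  The linear part \<open>m\<close> of \<open>h\<close> commutes with \<open>k\<close>, so the conjugate differs from \<open>h\<close> by the constant \<open>b\<close>
  below.
\<close>

lemma cay_hom_dilate_affine:
  assumes h: "cay_hom n s t h" "affine_map n h" and k: "[k * k' = 1] (mod n)"
  shows "cay_hom n s t (dilate k k' h)"
proof -
  obtain m where m: "\<And>i. [h i = h 0 + m * i] (mod n)"
    using h(2) by (auto simp: affine_map_def)
  define b where "b = k * h 0 - h 0"
  have "[dilate k k' h i = h i + b] (mod n)" for i
  proof -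
    have "[dilate k k' h i = k * (h 0 + m * (k' * i))] (mod n)"
      unfolding dilate_def by (intro cong_scalar_left m)
    also have "k * (h 0 + m * (k' * i)) = (k * k') * (m * i) + k * h 0" by (simp add: algebra_simps)
    also have "[\<dots> = 1 * (m * i) + k * h 0] (mod n)"
      by (intro cong_add cong_scalar_right k) simp
    also have "1 * (m * i) + k * h 0 = (h 0 + m * i) + b" by (simp add: b_def)
    also have "[\<dots> = h i + b] (mod n)"
      by (intro cong_add cong_sym[OF m]) simp
    finally show ?thesis .
  qed
  moreover have "cay_hom n s t (\<lambda>i. h i + b)"
    using h(1) unfolding cay_hom_def by (auto intro: cong_add)
  ultimately show ?thesis by (rule cay_hom_cong_fun[OF _ cong_sym, rotated])
qed

lemma affine_map_dilate:
  assumes k: "[k * k' = 1] (mod n)" and a: "affine_map n h"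
  shows "affine_map n (dilate k k' h)"
proof -
  obtain m where m: "\<And>i. [h i = h 0 + m * i] (mod n)"
    using a by (auto simp: affine_map_def)
  have "[dilate k k' h i = dilate k k' h 0 + (k * m * k') * i] (mod n)" for i
  proof -
    have "[dilate k k' h i = k * (h 0 + m * (k' * i))] (mod n)"
      unfolding dilate_def by (intro cong_scalar_left m)
    also have "k * (h 0 + m * (k' * i)) = dilate k k' h 0 + (k * m * k') * i"
      by (simp add: dilate_def algebra_simps)
    finally show ?thesis .
  qed
  then show ?thesis unfolding affine_map_def by blast
qed

lemma affine_map_cong:
  assumes "affine_map n h" "\<And>i. [h i = h' i] (mod n)"
  shows "affine_map n h'"
proof -
  obtain m where m: "\<And>i. [h i = h 0 + m * i] (mod n)"
    using assms(1) by (auto simp: affine_map_def)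
  have "[h' i = h' 0 + m * i] (mod n)" for i
  proof -
    have "[h' i = h i] (mod n)" by (rule cong_sym[OF assms(2)])
    also have "[h i = h 0 + m * i] (mod n)" by (rule m)
    also have "[h 0 + m * i = h' 0 + m * i] (mod n)" by (intro cong_add assms(2)) simp
    finally show ?thesis .
  qed
  then show ?thesis unfolding affine_map_def by blast
qed

lemma constant_step_iterate:
  fixes h :: "int \<Rightarrow> int"
  assumes "\<And>i. [h (i + c) = h i + m] (mod n)"
  shows "[h (c * j) = h 0 + m * j] (mod n)"
proof (induction j rule: int_induct[of _ 0])
  case base
  show ?case by simp
next
  case (step1 j)
  have "[h (c * j + c) = h (c * j) + m] (mod n)" by (rule assms)
  also have "[h (c * j) + m = h 0 + m * j + m] (mod n)" using step1 by (intro cong_add) auto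
  finally show ?case by (simp add: algebra_simps)
next
  case (step2 j)
  have "[h (c * (j - 1)) + m = h (c * (j - 1) + c)] (mod n)" by (rule cong_sym[OF assms])
  also have "c * (j - 1) + c = c * j" by (simp add: algebra_simps)
  also have "[h (c * j) = h 0 + m * j] (mod n)" by (rule step2)
  also have "h 0 + m * j = (h 0 + m * (j - 1)) + m" by (simp add: algebra_simps)
  finally show ?case by (simp only: cong_add_rcancel)
qed

text \<open>
  Since \<open>c\<close> is a unit, every residue class is reached by steps of size \<open>c\<close>.
\<close>

lemma affine_map_of_constant_step:
  assumes h: "\<And>i j. [i = j] (mod n) \<Longrightarrow> [h i = h j] (mod n)"
    and step: "\<And>i. [h (i + c) = h i + m] (mod n)" and c: "[c * c' = 1] (mod n)"
  shows "affine_map n h"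
proof -
  have "[h i = h 0 + (m * c') * i] (mod n)" for i
  proof -
    have "[c * (c' * i) = i] (mod n)"
      using cong_scalar_right[OF c, of i] by (simp add: mult.assoc)
    from cong_sym[OF h[OF this]]
    have "[h i = h (c * (c' * i))] (mod n)" .
    also have "[h (c * (c' * i)) = h 0 + m * (c' * i)] (mod n)"
      by (rule constant_step_iterate[of h c m n, OF step])
    finally show ?thesis by (simp add: mult.assoc)
  qed
  then show ?thesis unfolding affine_map_def by blast
qed

section \<open>Linear combinations and sums over a period\<close>

lemma dvd_lincomb:
  fixes n :: int
  assumes "n dvd a" "n dvd b" "c = p * a + q * b"
  shows "n dvd c"
  using assms by simp

lemma sum_window_shift:
  fixes F :: "int \<Rightarrow> int"
  shows "(\<Sum>j<m. F (i + 1 + int j)) = (\<Sum>j<m. F (i + int j)) + F (i + int m) - F i"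
  by (induction m) (auto simp: algebra_simps)

lemma sum_period_shift:
  fixes F :: "int \<Rightarrow> int"
  assumes "\<And>i. F (i + int m) = F i"
  shows "(\<Sum>j<m. F (i + int j)) = (\<Sum>j<m. F (int j))"
proof (induction i rule: int_induct[of _ 0])
  case (step1 i)
  then show ?case using sum_window_shift[of F i m] assms[of i] by simp
next
  case (step2 i)
  then show ?case using sum_window_shift[of F "i - 1" m] assms[of "i - 1"] by simp
qed simp

lemma sum_of_steps_cong:
  fixes h c :: "int \<Rightarrow> int"
  assumes "\<And>i. [h (i + 1) - h i = c i] (mod n)"
  shows "[h (i + int m) - h i = (\<Sum>j<m. c (i + int j))] (mod n)"
proof (induction m)
  case (Suc m)
  have "[(h (i + int m) - h i) + (h (i + int m + 1) - h (i + int m)) =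
      (\<Sum>j<m. c (i + int j)) + c (i + int m)] (mod n)"
    by (intro cong_add Suc assms)
  then show ?case by (simp add: algebra_simps)
qed simp


lemma eq_zero_of_periodic_sum_zero:
  fixes F :: "int \<Rightarrow> int"
  assumes "m > 0" "\<And>i. F (i mod int m) = F i" "\<And>i. F i \<ge> 0" "(\<Sum>j<m. F (int j)) = 0"
  shows "F i = 0"
proof -
  have "nat (i mod int m) < m" using assms(1) by (simp add: nat_less_iff)
  moreover have "\<forall>j\<in>{..<m}. F (int j) = 0"
    using assms(3,4) by (subst (asm) sum_nonneg_eq_0_iff) auto
  ultimately have "F (int (nat (i mod int m))) = 0" by blast
  then show ?thesis using assms(1,2) by simp
qed

section \<open>The connection set \<open>{0, 1, 2}\<close>\<close>

text \<open>
  The increments \<open>c i\<close> lift to integers between \<open>0\<close> and \<open>2\<close>, and because \<open>n \<ge> 5\<close> the arc of step \<open>2\<close>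
  bounds the sum of two neighbouring ones by \<open>2\<close>. Their sum over a period is \<open>n\<close> times a winding
  number \<open>q\<close>, which can only be \<open>0\<close> or \<open>1\<close>. For \<open>q = 0\<close> the map is constant. For \<open>q = 1\<close> all the bounds are
  tight, so the increments alternate between \<open>c i\<close> and \<open>2 - c i\<close>; as the period is odd, they equal \<open>1\<close>.
\<close>

lemma affine_map_of_hom_1_2:
  assumes n: "n \<ge> 5" "odd n" and h: "cay_hom n 1 2 h"
  shows "affine_map n h"
proof -
  define c where "c i = (h (i + 1) - h i) mod n" for i
  have c: "[h (i + 1) - h i = c i] (mod n)" for i by (simp add: c_def cong_def)
  have c_small: "0 \<le> c i \<and> c i \<le> 2" for i
  proof -
    obtain e where e: "e \<in> {0, 1, 2}" "[h (i + 1) - h i = e] (mod n)"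
      using cay_hom_step[OF h, of 1 i] by auto
    then have "c i = e mod n" by (simp add: c_def cong_def)
    also have "\<dots> = e" using e(1) n by auto
    finally show ?thesis using e(1) by auto
  qed
  have c_pair: "c i + c (i + 1) \<le> 2" for i
  proof -
    obtain e where e: "e \<in> {0, 1, 2}" "[h (i + 2) - h i = e] (mod n)"
      using cay_hom_step[OF h, of 2 i] by auto
    have "[h (i + 1) - h i + (h (i + 1 + 1) - h (i + 1)) = c i + c (i + 1)] (mod n)"
      by (intro cong_add c)
    then have "[h (i + 2) - h i = c i + c (i + 1)] (mod n)" by (simp add: add.assoc)
    from cong_trans[OF cong_sym[OF this] e(2)] have "[c i + c (i + 1) = e] (mod n)" .
    then have "c i + c (i + 1) = e"
      using e(1) c_small[of i] c_small[of "i + 1"] n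
      by (intro cong_less_imp_eq_int[of _ n]) auto
    then show ?thesis using e(1) by auto
  qed
  have c_per: "c i = c j" if "[i = j] (mod n)" for i j
    unfolding c_def cong_def[symmetric]
    by (intro cong_diff cay_hom_periodic[OF h] cong_add that) auto
  define m where "m = nat n"
  have m: "m > 0" "int m = n" using n by (auto simp: m_def)
  have c_m: "c (i + int m) = c i" for i by (rule c_per) (simp add: m cong_def)
  define N where "N = (\<Sum>j<m. c (int j))"
  have sum_N: "[h (0 + int m) - h 0 = N] (mod n)"
    unfolding N_def using sum_of_steps_cong[of h c n 0 m, OF c] by simp
  have "[h (0 + int m) - h 0 = h 0 - h 0] (mod n)"
    by (intro cong_diff cay_hom_periodic[OF h]) (auto simp: m cong_def)
  from cong_trans[OF cong_sym[OF sum_N] this] have "n dvd N" by (simp add: cong_0_iff)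
  then obtain q where q: "N = n * q" by blast
  have N_shift: "(\<Sum>j<m. c (int j + 1)) = N"
    using sum_period_shift[of c m 1, OF c_m] by (simp add: N_def add.commute)
  \<comment> \<open>The total slack in the bounds \<open>c i + c (i + 1) \<le> 2\<close>: non-negative, and zero for winding number 1.\<close>
  have defect: "(\<Sum>j<m. 2 - c (int j) - c (int j + 1)) = 2 * n - 2 * N"
    using N_shift by (simp add: sum_subtractf m N_def)
  have "0 \<le> (\<Sum>j<m. 2 - c (int j) - c (int j + 1))"
  proof (rule sum_nonneg)
    show "0 \<le> 2 - c (int j) - c (int j + 1)" for j using c_pair[of "int j"] by simp
  qed
  then have "N \<le> n" using defect by simp
  moreover have "N \<ge> 0" unfolding N_def using c_small by (intro sum_nonneg) auto
  ultimately have "n * q \<le> n * 1" "n * 0 \<le> n * q" unfolding q by simp_all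
  then have "q \<le> 1" "0 \<le> q" using n by (simp_all only: mult_le_cancel_left)
  then have "q = 0 \<or> q = 1" by linarith
  moreover have "affine_map n h" if c_const: "\<And>i. c i = v" for v
  proof (rule affine_map_of_constant_step[where c = 1 and c' = 1])
    show "[h (i + 1) = h i + v] (mod n)" for i
      using c[of i] c_const[of i] by (simp add: cong_iff_dvd_diff algebra_simps)
  qed (use cay_hom_periodic[OF h] in auto)
  moreover have "c i = 0" if "q = 0" for i
  proof (rule eq_zero_of_periodic_sum_zero[OF m(1), where F = c])
    show "c (i mod int m) = c i" for i by (rule c_per) (simp add: m cong_def)
    show "(\<Sum>j<m. c (int j)) = 0" using that q by (simp add: N_def)
  qed (use c_small in auto)
  moreover have "c i = 1" if "q = 1" for i
  proof -
    have tight: "2 - c i - c (i + 1) = 0" for i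
    proof (rule eq_zero_of_periodic_sum_zero[OF m(1), where F = "\<lambda>i. 2 - c i - c (i + 1)"])
      show "2 - c (i mod int m) - c (i mod int m + 1) = 2 - c i - c (i + 1)" for i
        using c_per[of "i mod int m" i] c_per[of "i mod int m + 1" "i + 1"]
        by (simp add: m cong_def mod_add_left_eq)
      show "(\<Sum>j<m. 2 - c (int j) - c (int j + 1)) = 0"
        unfolding defect using that q by simp
      show "0 \<le> 2 - c i - c (i + 1)" for i using c_pair[of i] by simp
    qed
    have even_shift: "c (i + 2 * int p) = c i" for p
    proof (induction p)
      case (Suc p)
      show ?case using Suc tight[of "i + 2 * int p"] tight[of "i + 2 * int p + 1"]
        by (simp add: algebra_simps)
    qed simp
    obtain p where p: "n = 2 * p + 1" using n(2) by (auto elim: oddE)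
    then have "p = int (nat p)" using n(1) by simp
    then have "c (i + 2 * p) = c i" using even_shift by metis
    then show "c i = 1"
      using tight[of "i + 2 * p"] c_m[of i] by (simp add: m p add.assoc)
  qed
  ultimately show ?thesis by blast
qed

section \<open>Endomorphisms when sums of two steps are distinct\<close>

text \<open>
  Here \<open>1/n\<close> times the matrix with columns \<open>(N1, N2)\<close> and \<open>(M1, M2)\<close> is a non-negative matrix with
  column sums at most \<open>1\<close> and with integral trace and determinant. Its determinant lies between \<open>-1\<close>
  and \<open>1\<close>, and the values \<open>1\<close> and \<open>-1\<close> force an entry \<open>1\<close>. If the determinant vanishes and the trace is \<open>1\<close>,
  then \<open>N2 \<le> M2\<close> and \<open>M1 \<le> N1\<close> by the column sums, and \<open>N1 * M2 = N2 * M1\<close> turns these into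
  equalities.
\<close>

lemma contraction_cases:
  fixes n N1 N2 M1 M2 :: int
  assumes n: "n > 0" and nonneg: "N1 \<ge> 0" "N2 \<ge> 0" "M1 \<ge> 0" "M2 \<ge> 0"
    and le: "N1 + N2 \<le> n" "M1 + M2 \<le> n"
    and trace: "n dvd N1 + M2" and det: "n * n dvd N1 * M2 - N2 * M1"
  shows "N1 = n \<or> N2 = n \<or> M1 = n \<or> M2 = n \<or> N1 = 0 \<and> N2 = 0 \<or> M1 = 0 \<and> M2 = 0 \<or>
    N1 = M1 \<and> N2 = M2 \<and> N1 + N2 = n"
proof -
  have full: "a = n" if "a * b \<ge> n * n" "0 \<le> a" "a \<le> n" "0 \<le> b" "b \<le> n" for a b :: int
  proof (rule ccontr)
    assume "a \<noteq> n"
    then have "a < n" using that by simp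
    have "a * b \<le> a * n" using that by (intro mult_left_mono) auto
    also have "\<dots> < n * n" using \<open>a < n\<close> n by simp
    finally show False using that by simp
  qed
  have up: "N1 * M2 \<ge> 0" "N2 * M1 \<ge> 0" using nonneg by auto
  consider "N1 * M2 - N2 * M1 \<ge> n * n" | "N2 * M1 - N1 * M2 \<ge> n * n" | "N1 * M2 = N2 * M1"
  proof -
    have nn: "n * n > 0" using n by simp
    obtain q where "N1 * M2 - N2 * M1 = n * n * q" using det by blast
    moreover have "n * n * q \<ge> n * n * 1" if "q \<ge> 1"
      using that nn by (intro mult_left_mono) auto
    moreover have "n * n * q \<le> n * n * (-1)" if "q \<le> -1"
      using that nn by (intro mult_left_mono) auto
    moreover have "q \<ge> 1 \<or> q \<le> -1 \<or> q = 0" by linarith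
    ultimately show thesis using that by (auto simp: mult.commute)
  qed
  then show ?thesis
  proof cases
    case 1
    then have "N1 = n" using full[of N1 M2] up nonneg le by simp
    then show ?thesis by simp
  next
    case 2
    then have "N2 = n" using full[of N2 M1] up nonneg le by simp
    then show ?thesis by simp
  next
    case 3
    obtain q where q: "N1 + M2 = n * q" using trace by blast
    have "n * q \<ge> n * 3" if "q \<ge> 3" using that n by simp
    moreover have "n * q \<le> n * (-1)" if "q \<le> -1" using that n by (intro mult_left_mono) auto
    ultimately have "q = 0 \<or> q = 1 \<or> q = 2" using q le nonneg n by linarith
    then consider "N1 = 0" "M2 = 0" | "N1 + M2 = n" | "N1 = n"
      using q le nonneg by fastforce
    then show ?thesis
    proof cases
      case 1
      with 3 show ?thesis by auto
    next
      case 2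
      have le': "N2 \<le> M2" "M1 \<le> N1" using 2 le by auto
      show ?thesis
      proof (cases "N1 = 0 \<or> M2 = 0")
        case True
        then show ?thesis using 2 by auto
      next
        case False
        then have pos: "N1 > 0" "M2 > 0" using nonneg by auto
        have "N2 * M1 \<le> N2 * N1" using le' nonneg by (intro mult_left_mono) auto
        then have "M2 * N1 \<le> N2 * N1" using 3 by (simp add: mult.commute)
        then have "N2 = M2" using pos le' by simp
        then have "M1 = N1" using 3 pos by simp
        then show ?thesis using \<open>N2 = M2\<close> 2 by simp
      qed
    qed simp
  qed
qed

text \<open>
  The assumptions on \<open>r\<close> say that the sums of two elements of \<open>{0, 1, r}\<close> are distinct modulo \<open>n\<close>:
  the difference of two such sums has the form \<open>a + b r\<close> with \<open>a\<close>, \<open>b\<close> as here.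
\<close>

lemma no_small_relation:
  fixes n r a b :: int
  assumes n: "n \<ge> 3" and nr: "\<not> n dvd r - 1" "\<not> n dvd r + 1" "\<not> n dvd r - 2" "\<not> n dvd r"
      "\<not> n dvd 2 * r - 1" "\<not> n dvd 2 * (r - 1)" "\<not> n dvd 2 * r"
    and rel: "n dvd a + b * r" and small: "\<bar>a\<bar> \<le> 2" "\<bar>b\<bar> \<le> 2" "\<bar>a + b\<bar> \<le> 2"
  shows "a = 0 \<and> b = 0"
proof -
  have nonneg: "a = 0 \<and> b = 0"
    if rel: "n dvd a + b * r" and small: "\<bar>a\<bar> \<le> 2" "\<bar>b\<bar> \<le> 2" "\<bar>a + b\<bar> \<le> 2" "b \<ge> 0"
    for a b
  proof -
    consider "b = 0" | "b = 1" | "b = 2" using small by linarith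
    then show ?thesis
    proof cases
      case 1
      then have "n dvd a" using rel by simp
      then show ?thesis using 1 small n dvd_imp_le_int[of a n] by auto
    next
      case 2
      then consider "a = -2" | "a = -1" | "a = 0" | "a = 1" using small by linarith
      then show ?thesis using 2 rel nr(1-4) by cases (simp_all add: add.commute)
    next
      case 3
      then consider "a = -2" | "a = -1" | "a = 0" using small by linarith
      then show ?thesis using 3 rel nr(5-7) by cases (simp_all add: algebra_simps)
    qed
  qed
  show ?thesis
  proof (cases "b \<ge> 0")
    case True
    then show ?thesis using nonneg rel small by blast
  next
    case False
    have "n dvd - (a + b * r)" using rel by (simp only: dvd_minus_iff)
    then have "n dvd - a + (- b) * r" by simp
    moreover have "\<bar>- a\<bar> \<le> 2" "\<bar>- b\<bar> \<le> 2" "\<bar>- a + - b\<bar> \<le> 2" "- b \<ge> 0"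
      using small False by linarith+
    ultimately have "- a = 0 \<and> - b = 0" by (rule nonneg)
    then show ?thesis by simp
  qed
qed

text \<open>
  The counting argument from the introduction. The indicator \<open>ind e i j\<close> records whether \<open>h\<close> increases
  by \<open>e\<close> from \<open>i\<close> to \<open>j\<close>, and \<open>total e c / n\<close> is the proportion of arcs of step \<open>c\<close> with increment \<open>e\<close>: this
  is the entry of the matrix \<open>A\<close> in row \<open>e\<close> and column \<open>c\<close>. The lattice \<open>L\<close> is spanned by \<open>(n, 0)\<close> and
  \<open>(-r, 1)\<close>; their images under \<open>A\<close> are \<open>(total 1 1, total r 1)\<close> and \<open>(circ 1 0, circ r 0)\<close>.
\<close>

lemma affine_or_closed_walk:
  assumes n: "n \<ge> 3" and r: "0 \<le> r" and r': "[r * r' = 1] (mod n)"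
    and sq: "\<not> n dvd r - 1" "\<not> n dvd r + 1" "\<not> n dvd r - 2" "\<not> n dvd 2 * r - 1"
      "\<not> n dvd 2 * (r - 1)"
    and h: "cay_hom n 1 r h"
  shows "affine_map n h \<or>
    (\<exists>x y. 0 < x \<and> 0 < y \<and> x + y = gcd n (1 - r) \<and> n dvd x + y * r)"
proof -
  have unit_r: "n dvd a" if "n dvd a * r" for a
  proof (rule dvd_lincomb[OF that])
    show "n dvd r * r' - 1" using r' by (simp add: cong_iff_dvd_diff)
    show "a = r' * (a * r) + (- a) * (r * r' - 1)" by (simp add: algebra_simps)
  qed
  have n1: "\<not> n dvd 1" "\<not> n dvd 2" using n by (auto dest!: zdvd_imp_le)
  have nr: "\<not> n dvd r" "\<not> n dvd 2 * r"
    using unit_r[of 1] unit_r[of 2] n1 by auto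
  define ind where "ind e i j = (if [h j - h i = e] (mod n) then 1 else 0 :: int)" for e i j
  have ind_per: "ind e i j = ind e i' j'" if "[i = i'] (mod n)" "[j = j'] (mod n)" for e i j i' j'
  proof -
    have "[h j - h i = h j' - h i'] (mod n)"
      by (intro cong_diff cay_hom_periodic[OF h] that)
    then have "[h j - h i = e] (mod n) \<longleftrightarrow> [h j' - h i' = e] (mod n)"
      by (auto simp: cong_def)
    then show ?thesis by (simp add: ind_def)
  qed
  have ind_nonneg: "0 \<le> ind e i j" for e i j by (simp add: ind_def)
  have ind_disjoint: "ind 1 i j + ind r i j \<le> 1" for i j
  proof -
    have "\<not> ([h j - h i = 1] (mod n) \<and> [h j - h i = r] (mod n))"
    proof
      assume "[h j - h i = 1] (mod n) \<and> [h j - h i = r] (mod n)"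
      then have "[r = 1] (mod n)" by (auto simp: cong_def)
      then show False using sq(1) by (simp add: cong_iff_dvd_diff)
    qed
    then show ?thesis by (auto simp: ind_def)
  qed
  have ind_arc: "[h (i + c) - h i = ind 1 i (i + c) + ind r i (i + c) * r] (mod n)"
    if c: "c \<in> {1, r}" for i c
  proof -
    obtain e where e: "e \<in> {0, 1, r}" "[h (i + c) - h i = e] (mod n)"
      using cay_hom_step[OF h c] by blast
    have "[h (i + c) - h i = x] (mod n) \<longleftrightarrow> [e = x] (mod n)" for x
      using e(2) by (auto simp: cong_def)
    then have ind_e: "ind x i (i + c) = (if n dvd e - x then 1 else 0)" for x
      by (simp add: ind_def cong_iff_dvd_diff)
    have "\<not> n dvd 1 - r" using sq(1) dvd_diff_commute by blast
    then have "ind 1 i (i + c) + ind r i (i + c) * r = e"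
      using e(1) n1(1) nr(1) sq(1) unfolding ind_e by (elim insertE) simp_all
    with e(2) show ?thesis by simp
  qed
  \<comment> \<open>Both paths around the square \<open>i, i + 1, i + r, i + 1 + r\<close> have the same total increment, hence
    equally many increments of each kind.\<close>
  have square: "ind e i (i + 1) + ind e (i + 1) (i + 1 + r) = ind e i (i + r) + ind e (i + r) (i + r + 1)"
    if "e \<in> {1, r}" for e i
  proof -
    define P1 where "P1 = ind 1 i (i + 1) + ind 1 (i + 1) (i + 1 + r)"
    define P2 where "P2 = ind r i (i + 1) + ind r (i + 1) (i + 1 + r)"
    define Q1 where "Q1 = ind 1 i (i + r) + ind 1 (i + r) (i + r + 1)"
    define Q2 where "Q2 = ind r i (i + r) + ind r (i + r) (i + r + 1)"
    have "[(h (i + 1) - h i) + (h (i + 1 + r) - h (i + 1)) =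
        (ind 1 i (i + 1) + ind r i (i + 1) * r) +
        (ind 1 (i + 1) (i + 1 + r) + ind r (i + 1) (i + 1 + r) * r)] (mod n)"
      by (intro cong_add ind_arc) auto
    then have P: "[h (i + 1 + r) - h i = P1 + P2 * r] (mod n)"
      by (simp add: P1_def P2_def algebra_simps)
    have "[(h (i + r) - h i) + (h (i + r + 1) - h (i + r)) =
        (ind 1 i (i + r) + ind r i (i + r) * r) +
        (ind 1 (i + r) (i + r + 1) + ind r (i + r) (i + r + 1) * r)] (mod n)"
      by (intro cong_add ind_arc) auto
    then have Q: "[h (i + 1 + r) - h i = Q1 + Q2 * r] (mod n)"
      by (simp add: Q1_def Q2_def algebra_simps)
    from cong_trans[OF cong_sym[OF P] Q]
    have dvd: "n dvd (P1 - Q1) + (P2 - Q2) * r"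
      by (simp add: cong_iff_dvd_diff algebra_simps)
    have bounds: "0 \<le> P1" "0 \<le> P2" "P1 + P2 \<le> 2" "0 \<le> Q1" "0 \<le> Q2" "Q1 + Q2 \<le> 2"
      using ind_nonneg ind_disjoint[of i "i + 1"] ind_disjoint[of "i + 1" "i + 1 + r"]
        ind_disjoint[of i "i + r"] ind_disjoint[of "i + r" "i + r + 1"]
      by (simp_all add: P1_def P2_def Q1_def Q2_def)
    have "P1 = Q1 \<and> P2 = Q2"
      using no_small_relation[OF n sq(1-3) nr(1) sq(4,5) nr(2) dvd] bounds by auto
    then show ?thesis
      using that by (auto simp: P1_def P2_def Q1_def Q2_def)
  qed

  define m where "m = nat n"
  define p where "p = nat r"
  have m: "m > 0" "int m = n" and p: "int p = r" using n r by (auto simp: m_def p_def)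
  define total where "total e c = (\<Sum>j<m. ind e (int j) (int j + c))" for e c
  have periodic_step: "ind e (i + int m) (i + int m + c) = ind e i (i + c)"
    "ind e (i mod int m) (i mod int m + c) = ind e i (i + c)" for e i c
    by (intro ind_per cong_add; simp add: m cong_def)+
  \<comment> \<open>The count along the closed path made of one step \<open>r\<close> and \<open>r\<close> steps \<open>-1\<close>; by the square rule it
    does not depend on the starting point.\<close>
  define circ where "circ e i = ind e i (i + r) - (\<Sum>q<p. ind e (i + int q) (i + int q + 1))" for e i
  have circ_step: "circ e (i + 1) = circ e i" if e: "e \<in> {1, r}" for e i
    using square[OF e, of i] sum_window_shift[of "\<lambda>i. ind e i (i + 1)" i p]
    unfolding circ_def by (simp add: p)
  have circ_const: "circ e i = circ e 0" if e: "e \<in> {1, r}" for e i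
  proof (induction i rule: int_induct[of _ 0])
    case (step1 i)
    then show ?case using circ_step[OF e] by simp
  next
    case (step2 i)
    then show ?case using circ_step[OF e, of "i - 1"] by simp
  qed simp
  have circ_total: "n * circ e 0 = total e r - r * total e 1" if e: "e \<in> {1, r}" for e
  proof -
    have "(\<Sum>j<m. circ e (int j)) = (\<Sum>j<m. circ e 0)"
      by (rule sum.cong[OF refl circ_const[OF e]])
    then have "(\<Sum>j<m. circ e (int j)) = n * circ e 0" by (simp add: m)
    moreover have "(\<Sum>j<m. circ e (int j)) =
        total e r - (\<Sum>j<m. \<Sum>q<p. ind e (int j + int q) (int j + int q + 1))"
      by (simp add: circ_def total_def sum_subtractf)
    moreover have "(\<Sum>j<m. \<Sum>q<p. ind e (int j + int q) (int j + int q + 1)) =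
        (\<Sum>q<p. \<Sum>j<m. ind e (int q + int j) (int q + int j + 1))"
      by (subst sum.swap) (simp add: add.commute)
    moreover have "(\<Sum>j<m. ind e (int q + int j) (int q + int j + 1)) = total e 1" for q
      using sum_period_shift[of "\<lambda>i. ind e i (i + 1)" m "int q", OF periodic_step(1)]
      by (simp add: total_def)
    ultimately show ?thesis by (simp add: p)
  qed
  have sum_unit_steps: "[h (i + int k) - h i =
      (\<Sum>j<k. ind 1 (i + int j) (i + int j + 1) + ind r (i + int j) (i + int j + 1) * r)] (mod n)" for i k
    by (rule sum_of_steps_cong) (simp add: ind_arc)
  have lattice_total: "n dvd total 1 1 + total r 1 * r"
  proof -
    have "[h (0 + int m) - h 0 = total 1 1 + total r 1 * r] (mod n)"
      using sum_unit_steps[of 0 m] by (simp add: total_def sum.distrib sum_distrib_right)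
    moreover have "[h (0 + int m) - h 0 = h 0 - h 0] (mod n)"
      by (intro cong_diff cay_hom_periodic[OF h]) (auto simp: m cong_def)
    ultimately have "[total 1 1 + total r 1 * r = 0] (mod n)" by (simp add: cong_def)
    then show ?thesis by (simp add: cong_0_iff)
  qed
  have lattice_circ: "n dvd circ 1 0 + circ r 0 * r"
  proof -
    have "[(h (0 + r) - h 0) - (h (0 + int p) - h 0) =
        (ind 1 0 (0 + r) + ind r 0 (0 + r) * r) -
        (\<Sum>j<p. ind 1 (0 + int j) (0 + int j + 1) + ind r (0 + int j) (0 + int j + 1) * r)] (mod n)"
      by (intro cong_diff ind_arc sum_unit_steps) simp
    then have "[0 = circ 1 0 + circ r 0 * r] (mod n)"
      by (simp add: p circ_def sum.distrib left_diff_distrib diff_diff_eq add_diff_eq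
          diff_add_eq flip: sum_distrib_right)
    then show ?thesis using cong_0_iff cong_sym by blast
  qed
  have total_nonneg: "total e c \<ge> 0" for e c
    unfolding total_def by (intro sum_nonneg ind_nonneg)
  have total_le: "total 1 c + total r c \<le> n" for c
  proof -
    have "total 1 c + total r c = (\<Sum>j<m. ind 1 (int j) (int j + c) + ind r (int j) (int j + c))"
      by (simp add: total_def sum.distrib)
    also have "\<dots> \<le> (\<Sum>j<m. 1)" by (intro sum_mono ind_disjoint)
    finally show ?thesis by (simp add: m)
  qed
  have all: "ind e i (i + c) = 1" if "total e c = n" for e c i
  proof -
    have "1 - ind e i (i + c) = 0"
    proof (rule eq_zero_of_periodic_sum_zero[OF m(1), where F = "\<lambda>i. 1 - ind e i (i + c)"])
      show "(\<Sum>j<m. 1 - ind e (int j) (int j + c)) = 0"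
        using that by (simp add: sum_subtractf total_def m)
      show "0 \<le> 1 - ind e i (i + c)" for i by (simp add: ind_def)
    qed (simp add: periodic_step)
    then show ?thesis by simp
  qed
  have none: "ind e i (i + c) = 0" if "total e c = 0" for e c i
  proof (rule eq_zero_of_periodic_sum_zero[OF m(1), where F = "\<lambda>i. ind e i (i + c)"])
    show "(\<Sum>j<m. ind e (int j) (int j + c)) = 0" using that by (simp add: total_def)
  qed (simp_all add: periodic_step ind_nonneg)
  have affine: "affine_map n h" if c: "c \<in> {1, r}" and step: "\<And>i. [h (i + c) = h i + e] (mod n)" for c e
  proof -
    have "\<exists>c'. [c * c' = 1] (mod n)" using c r' by (auto intro: exI[of _ 1])
    then show ?thesis
      using affine_map_of_constant_step[of n h c e, OF cay_hom_periodic[OF h] step] by blast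
  qed
  have affine_all: "affine_map n h" if "c \<in> {1, r}" "total e c = n" for e c
  proof (rule affine[OF that(1)])
    show "[h (i + c) = h i + e] (mod n)" for i
      using all[OF that(2), of i] by (simp add: ind_def cong_iff_dvd_diff algebra_simps split: if_splits)
  qed
  have affine_none: "affine_map n h" if "c \<in> {1, r}" "total 1 c = 0" "total r c = 0" for c
  proof (rule affine[OF that(1)])
    show "[h (i + c) = h i + 0] (mod n)" for i
      using ind_arc[OF that(1), of i] none[OF that(2), of i] none[OF that(3), of i]
      by (simp add: cong_iff_dvd_diff)
  qed
  \<comment> \<open>\<open>n\<close> divides the determinant of any two vectors of \<open>L\<close>. Applied to \<open>A (n, 0)\<close> with \<open>(-r, 1)\<close>, to
    \<open>(n, 0)\<close> with \<open>A (-r, 1)\<close>, and to both images, this gives the integrality of trace and determinant.\<close>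
  have "n dvd total 1 1 + total r r"
    by (rule dvd_lincomb[OF lattice_total dvd_refl, of _ 1 "circ r 0"])
      (use circ_total[of r] in \<open>simp add: algebra_simps\<close>)
  moreover have "n * n dvd total 1 1 * total r r - total r 1 * total 1 r"
  proof -
    have "n dvd total 1 1 * circ r 0 - total r 1 * circ 1 0"
      by (rule dvd_lincomb[OF lattice_total lattice_circ, of _ "circ r 0" "- total r 1"])
        (simp add: algebra_simps)
    then have "n * n dvd n * (total 1 1 * circ r 0 - total r 1 * circ 1 0)" by simp
    also have "n * (total 1 1 * circ r 0 - total r 1 * circ 1 0) =
        total 1 1 * (n * circ r 0) - total r 1 * (n * circ 1 0)" by (simp add: algebra_simps)
    also have "\<dots> = total 1 1 * total r r - total r 1 * total 1 r"
      by (simp add: circ_total algebra_simps)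
    finally show ?thesis .
  qed
  moreover have "n > 0" using n by simp
  ultimately have "total 1 1 = n \<or> total r 1 = n \<or> total 1 r = n \<or> total r r = n \<or>
      total 1 1 = 0 \<and> total r 1 = 0 \<or> total 1 r = 0 \<and> total r r = 0 \<or>
      total 1 1 = total 1 r \<and> total r 1 = total r r \<and> total 1 1 + total r 1 = n"
    by (intro contraction_cases total_nonneg total_le)
  then consider "affine_map n h"
    | "total 1 1 = total 1 r" "total r 1 = total r r" "total 1 1 + total r 1 = n"
    using affine_all affine_none by blast
  then show ?thesis
  proof cases
    case 2
    define d where "d = gcd n (1 - r)"
    have d: "d > 0" "d dvd n" "d dvd 1 - r" using n by (simp_all add: d_def)
    obtain u v where uv: "u * n + v * (1 - r) = d"
      using bezout_int[of n "1 - r"] by (auto simp: d_def)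
    \<comment> \<open>\<open>(x, y)\<close> is the image under \<open>A\<close> of \<open>u (n, 0) + v (-r, 1)\<close>, a vector of \<open>L\<close> with coordinate
      sum \<open>d\<close>.\<close>
    define x where "x = u * total 1 1 + v * circ 1 0"
    define y where "y = u * total r 1 + v * circ r 0"
    have "n * x = u * n * total 1 1 + v * (n * circ 1 0)" by (simp add: x_def algebra_simps)
    also have "\<dots> = (u * n + v * (1 - r)) * total 1 1"
      using 2 by (simp add: circ_total algebra_simps)
    finally have nx: "n * x = d * total 1 1" by (simp only: uv)
    have "n * y = u * n * total r 1 + v * (n * circ r 0)" by (simp add: y_def algebra_simps)
    also have "\<dots> = (u * n + v * (1 - r)) * total r 1"
      using 2 by (simp add: circ_total algebra_simps)
    finally have ny: "n * y = d * total r 1" by (simp only: uv)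
    have "n * (x + y) = d * (total 1 1 + total r 1)" using nx ny by (simp add: distrib_left)
    then have "n * (x + y) = n * d" using 2 by simp
    then have xy: "x + y = d" using n by simp
    have "n * x \<ge> 0" "n * y \<ge> 0" using nx ny d total_nonneg by simp_all
    then have nonneg: "x \<ge> 0" "y \<ge> 0" using n by (simp_all add: zero_le_mult_iff)
    have rel: "n dvd x + y * r"
      by (rule dvd_lincomb[OF lattice_total lattice_circ, of _ u v])
        (simp add: x_def y_def algebra_simps)
    have "\<not> n dvd d" using d(3) sq(1) dvd_trans dvd_diff_commute by blast
    moreover have "n dvd d" if "x = 0" using that rel xy unit_r[of d] by simp
    moreover have "n dvd d" if "y = 0" using that rel xy by simp
    ultimately have "x \<noteq> 0" "y \<noteq> 0" by blast+
    then have "0 < x" "0 < y" using nonneg by simp_all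
    then show ?thesis using xy rel unfolding d_def by blast
  qed simp
qed

section \<open>Steps that agree modulo half of \<open>n\<close>\<close>

text \<open>
  Modulo \<open>d\<close> both steps are \<open>1\<close>, and \<open>h\<close> has increments \<open>inc i\<close> in \<open>{0, 1}\<close>. Their sum \<open>T\<close> over a period of
  length \<open>2 d\<close> is a multiple of \<open>d\<close>, and the extreme values \<open>0\<close> and \<open>2 d\<close> give the two alternatives. The
  value \<open>d\<close> is impossible: the arc of step \<open>1 + d\<close> forces each sum \<open>W i\<close> over half a period to be within \<open>1\<close>
  of \<open>0\<close> or of \<open>d\<close>. These sums change by at most \<open>1\<close> from \<open>i\<close> to \<open>i + 1\<close>, so they all lie on the same
  side, whereas \<open>W i + W (i + d) = d\<close>.
\<close>

lemma constant_or_translation_mod_half: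
  assumes n: "n = 2 * d" "d \<ge> 4" and h: "cay_hom n 1 (1 + d) h"
  shows "(\<forall>i. [h i = h 0] (mod n)) \<or> (\<forall>i. [h i = h 0 + i] (mod d))"
proof -
  define inc where "inc i = (if [h (i + 1) = h i] (mod n) then 0 else 1 :: int)" for i
  have mod_d: "[a = b] (mod d)" if "[a = b] (mod n)" for a b
    using that n(1) by (simp add: cong_modulus_mult mult.commute[of 2])
  have e_mod_d: "[e = 0] (mod d) \<or> [e = 1] (mod d)" if "e \<in> {0, 1, 1 + d}" for e
    using that by (auto simp: cong_def)
  have inc: "[h (i + 1) - h i = inc i] (mod d)" for i
  proof (cases "[h (i + 1) = h i] (mod n)")
    case True
    then show ?thesis using mod_d[OF True] by (simp add: inc_def cong_iff_dvd_diff)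
  next
    case False
    obtain e where e: "e \<in> {0, 1, 1 + d}" "[h (i + 1) - h i = e] (mod n)"
      using cay_hom_step[OF h, of 1 i] by auto
    have "e \<noteq> 0" using False e(2) by (auto simp: cong_iff_dvd_diff)
    then have "[e = 1] (mod d)" using e(1) by (auto simp: cong_def)
    with cong_trans[OF mod_d[OF e(2)]] show ?thesis using False by (simp add: inc_def)
  qed
  have inc_01: "0 \<le> inc i" "inc i \<le> 1" for i by (simp_all add: inc_def)
  define m where "m = nat d"
  have m: "int m = d" using n by (simp add: m_def)
  define W where "W i = (\<Sum>j<m. inc (i + int j))" for i
  have W_step: "W (i + 1) = W i + inc (i + d) - inc i" for i
    using sum_window_shift[of inc i m] by (simp add: W_def m)
  have W_cong: "[h (i + d) - h i = W i] (mod d)" for i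
    using sum_of_steps_cong[of h inc d i m, OF inc] by (simp add: W_def m)
  have W_ge: "inc i \<le> W i" and W_le: "W i \<le> d - 1 + inc i" for i
  proof -
    obtain m' where m': "m = Suc m'" using n m by (cases m) auto
    have W: "W i = inc i + (\<Sum>j<m'. inc (i + 1 + int j))"
      by (simp add: W_def m' sum.lessThan_Suc_shift add.assoc del: sum.lessThan_Suc)
    have "0 \<le> (\<Sum>j<m'. inc (i + 1 + int j))" using inc_01 by (intro sum_nonneg) auto
    then show "inc i \<le> W i" using W by simp
    have "(\<Sum>j<m'. inc (i + 1 + int j)) \<le> (\<Sum>j<m'. 1)" using inc_01 by (intro sum_mono) auto
    then show "W i \<le> d - 1 + inc i" using W m m' by simp
  qed
  have inc_n: "inc (i + d + d) = inc i" for i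
  proof -
    have "[i + d + d = i] (mod n)" by (simp add: cong_iff_dvd_diff n(1))
    then have "[h (i + d + d + 1) = h (i + 1)] (mod n)" "[h (i + d + d) = h i] (mod n)"
      by (intro cay_hom_periodic[OF h] cong_add cong_refl; assumption)+
    then show ?thesis by (simp add: inc_def cong_def)
  qed
  define T where "T = W 0 + W d"
  have T: "W i + W (i + d) = T" for i
  proof (induction i rule: int_induct[of _ 0])
    case (step1 i)
    then show ?case
      using W_step[of i] W_step[of "i + d"] inc_n[of i] by (simp add: algebra_simps)
  next
    case (step2 i)
    then show ?case
      using W_step[of "i - 1"] W_step[of "i - 1 + d"] inc_n[of "i - 1"] by (simp add: algebra_simps)
  qed (simp add: T_def)
  have "[(h (0 + d) - h 0) + (h (d + d) - h d) = W 0 + W d] (mod d)"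
    by (intro cong_add W_cong)
  moreover have "[h (d + d) - h 0 = h 0 - h 0] (mod d)"
    using n(1) by (intro cong_diff mod_d cay_hom_periodic[OF h]) (auto simp: cong_iff_dvd_diff)
  ultimately have "d dvd T" by (simp add: T_def cong_def mod_eq_0_iff_dvd)
  then obtain q where q: "T = d * q" by blast
  have "d * 0 \<le> T" "T \<le> d * 2"
    using T_def W_ge[of 0] W_ge[of d] W_le[of 0] W_le[of d] inc_01[of 0] inc_01[of d]
    by linarith+
  then have "d * 0 \<le> d * q" "d * q \<le> d * 2" unfolding q .
  then have "0 \<le> q" "q \<le> 2" using n(2) by (simp_all only: mult_le_cancel_left)
  then consider "T = 0" | "T = d" | "T = 2 * d"
    using q by (cases "q = 0"; cases "q = 1"; cases "q = 2") auto
  then show ?thesis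
  proof cases
    case 1
    have inc_0: "inc i = 0" for i
      using T[of i] 1 W_ge[of i] W_ge[of "i + d"] inc_01[of i] inc_01[of "i + d"] by linarith
    have "[h (i + 1) = h i + 0] (mod n)" for i
      using inc_0[of i] by (simp add: inc_def split: if_splits)
    from constant_step_iterate[of h 1 0 n, OF this] show ?thesis by simp
  next
    case 2
    have low: "W i \<le> 1 \<or> W i \<ge> d - 1" for i
    proof -
      obtain e where e: "e \<in> {0, 1, 1 + d}" "[h (i + (1 + d)) - h i = e] (mod n)"
        using cay_hom_step[OF h, of "1 + d" i] by auto
      have "[(h (i + d) - h i) + (h (i + d + 1) - h (i + d)) = W i + inc (i + d)] (mod d)"
        by (intro cong_add W_cong inc)
      then have sum: "[h (i + (1 + d)) - h i = W i + inc (i + d)] (mod d)"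
        by (simp add: algebra_simps)
      obtain b where b: "b \<in> {0, 1}" "[e = b] (mod d)" using e_mod_d[OF e(1)] by auto
      have "[W i + inc (i + d) = b] (mod d)"
        using sum mod_d[OF e(2)] b(2) by (simp add: cong_def)
      then have "d dvd W i + inc (i + d) - b" by (simp add: cong_iff_dvd_diff)
      then obtain q where q: "W i + inc (i + d) - b = d * q" by blast
      have "0 \<le> b" "b \<le> 1" using b(1) by auto
      then have "d * (-1) < W i + inc (i + d) - b" "W i + inc (i + d) - b < d * 2"
        using n(2) W_ge[of i] W_le[of i] inc_01[of i] inc_01[of "i + d"] by linarith+
      then have "d * (-1) < d * q" "d * q < d * 2" unfolding q .
      then have "-1 < q" "q < 2" using n(2) by (simp_all only: mult_less_cancel_left)
      then have "q = 0 \<or> q = 1" by linarith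
      then show ?thesis using q b(1) inc_01[of "i + d"] by auto
    qed
    have low_step: "W (i + 1) \<le> 1 \<longleftrightarrow> W i \<le> 1" for i
      using low[of i] low[of "i + 1"] W_step[of i] inc_01[of i] inc_01[of "i + d"] n(2) by linarith
    have "W i \<le> 1 \<longleftrightarrow> W 0 \<le> 1" for i
    proof (induction i rule: int_induct[of _ 0])
      case (step2 i)
      then show ?case using low_step[of "i - 1"] by simp
    qed (use low_step in auto)
    from this[of d] have False
      using T[of 0] 2 low[of 0] low[of d] n(2) by (simp; linarith)
    then show ?thesis ..
  next
    case 3
    have "inc i = 1" for i
      using T[of i] 3 W_le[of i] W_le[of "i + d"] inc_01[of i] inc_01[of "i + d"] by linarith
    then have "[h (i + 1) = h i + 1] (mod d)" for i
      using inc[of i] by (simp add: cong_iff_dvd_diff algebra_simps)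
    from constant_step_iterate[of h 1 1 d, OF this] show ?thesis by simp
  qed
qed

text \<open>
  Being congruent to a translation modulo \<open>d\<close> is preserved by conjugation, and it makes a periodic map
  an endomorphism, because \<open>1\<close> and \<open>1 + d\<close> are all the residues modulo \<open>n\<close> that are \<open>1\<close> modulo \<open>d\<close>.
\<close>

lemma stabilises_twin_steps:
  assumes n: "n = 2 * d" "d \<ge> 4" and k: "[k * k' = 1] (mod n)"
  shows "stabilises n 1 (1 + d) k k'"
  unfolding stabilises_def
proof (intro allI impI)
  fix h assume h: "cay_hom n 1 (1 + d) h"
  consider "\<forall>i. [h i = h 0] (mod n)" | "\<forall>i. [h i = h 0 + i] (mod d)"
    using constant_or_translation_mod_half[OF n h] by blast
  then show "cay_hom n 1 (1 + d) (dilate k k' h)"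
  proof cases
    case 1
    then have "affine_map n h" unfolding affine_map_def by (intro exI[of _ 0]) simp
    then show ?thesis by (rule cay_hom_dilate_affine[OF h _ k])
  next
    case 2
    have k_d: "[k * k' = 1] (mod d)"
      using k n(1) by (simp add: cong_modulus_mult mult.commute[of 2])
    have dil: "[dilate k k' h i = k * h 0 + i] (mod d)" for i
    proof -
      have "[dilate k k' h i = k * (h 0 + k' * i)] (mod d)"
        unfolding dilate_def using 2 by (intro cong_scalar_left) blast
      also have "k * (h 0 + k' * i) = k * h 0 + (k * k') * i" by (simp add: algebra_simps)
      also have "[\<dots> = k * h 0 + 1 * i] (mod d)"
        by (intro cong_add cong_scalar_right k_d) simp
      finally show ?thesis by simp
    qed
    show ?thesis
      unfolding cay_hom_def
    proof (intro conjI allI ballI impI)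
      show "[dilate k k' h i = dilate k k' h j] (mod n)" if "[i = j] (mod n)" for i j
        unfolding dilate_def using that by (intro cong_scalar_left cay_hom_periodic[OF h])
    next
      fix i c assume c: "c \<in> {1, 1 + d}"
      have "[dilate k k' h (i + c) - dilate k k' h i = (k * h 0 + (i + c)) - (k * h 0 + i)] (mod d)"
        by (intro cong_diff dil)
      then have "d dvd dilate k k' h (i + c) - dilate k k' h i - c"
        by (simp add: cong_iff_dvd_diff)
      moreover have "d dvd c - 1" using c by auto
      ultimately have "d dvd dilate k k' h (i + c) - dilate k k' h i - 1"
        by (rule dvd_lincomb[of _ _ _ _ 1 1]) simp
      then obtain q where q: "dilate k k' h (i + c) - dilate k k' h i - 1 = d * q" by blast
      show "\<exists>e\<in>{0, 1, 1 + d}. [dilate k k' h (i + c) - dilate k k' h i = e] (mod n)"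
      proof (cases "even q")
        case True
        then obtain p where "q = 2 * p" by blast
        then have "dilate k k' h (i + c) - dilate k k' h i - 1 = n * p" using q n(1) by simp
        then have "[dilate k k' h (i + c) - dilate k k' h i = 1] (mod n)"
          by (simp add: cong_iff_dvd_diff)
        then show ?thesis by blast
      next
        case False
        then obtain p where "q = 2 * p + 1" by (auto elim: oddE)
        then have "dilate k k' h (i + c) - dilate k k' h i - (1 + d) = n * p"
          using q n(1) by (simp add: algebra_simps)
        then have "[dilate k k' h (i + c) - dilate k k' h i = 1 + d] (mod n)"
          by (simp add: cong_iff_dvd_diff)
        then show ?thesis by blast
      qed
    qed
  qed
qed

section \<open>Connection sets without a closed walk\<close>

text \<open>
  The case \<open>2 r \<equiv> 1\<close> is reduced to \<open>r = 2\<close>: conjugation by \<open>2\<close> turns the steps \<open>1, r\<close> into \<open>2, 1\<close>.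
  Coprimality makes \<open>n\<close> odd for \<open>r = 2\<close> and \<open>2 r \<equiv> 1\<close>, and \<open>r\<close> odd for \<open>n = 2 (r - 1)\<close>; together with
  \<open>r \<noteq> n - 1\<close> this gives the lower bounds \<open>n \<ge> 5\<close> and \<open>r - 1 \<ge> 4\<close> of the lemmas used there.
\<close>

lemma stabilises_of_no_closed_walk:
  assumes n: "n \<ge> 3" and r: "0 < r" "r < n" "r \<noteq> 1" "r \<noteq> n - 1" and cop: "coprime r n"
    and k: "[k * k' = 1] (mod n)"
    and no: "\<not> (2 * gcd n (1 - r) < n \<and>
      (\<exists>x y. 0 < x \<and> 0 < y \<and> x + y = gcd n (1 - r) \<and> n dvd x + y * r))"
  shows "stabilises n 1 r k k'"
proof -
  have small: "\<not> n dvd a" if "0 < a" "a < n" for a using that zdvd_not_zless by blast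
  have n3: "n > 3" using n r by linarith
  obtain r' where r': "[r * r' = 1] (mod n)" using cop coprime_iff_invertible_int by blast
  have d_half: "2 * gcd n (1 - r) < n" if "\<not> n dvd 2 * (r - 1)"
  proof -
    obtain e where e: "n = gcd n (1 - r) * e" by (meson gcd_dvd1 dvdE)
    have d0: "gcd n (1 - r) > 0" using n by simp
    have "\<not> n dvd 2 * gcd n (1 - r)"
    proof
      assume "n dvd 2 * gcd n (1 - r)"
      also have "\<dots> dvd 2 * (1 - r)" by (intro mult_dvd_mono) auto
      finally have "n dvd - (2 * (1 - r))" by (simp only: dvd_minus_iff)
      then show False using that by (simp add: algebra_simps)
    qed
    then have "e \<noteq> 1" "e \<noteq> 2" using e by (auto simp: mult.commute)
    moreover have "e > 0" using e d0 n3 by (metis zero_less_mult_pos order.strict_trans zero_less_numeral)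
    ultimately have "3 \<le> e" by linarith
    then have "gcd n (1 - r) * 3 \<le> gcd n (1 - r) * e" using d0 by (intro mult_left_mono) auto
    then show ?thesis using e d0 by linarith
  qed
  have all_affine: "stabilises n 1 r k k'" if "\<And>h. cay_hom n 1 r h \<Longrightarrow> affine_map n h"
    unfolding stabilises_def using that cay_hom_dilate_affine[OF _ _ k] by blast
  consider "n dvd 2 * (r - 1)" | "n dvd r - 2" | "n dvd 2 * r - 1"
    | "\<not> n dvd 2 * (r - 1)" "\<not> n dvd r - 2" "\<not> n dvd 2 * r - 1" by blast
  then show ?thesis
  proof cases
    case 1
    then obtain q where q: "2 * (r - 1) = n * q" by blast
    have "n * 0 < n * q" "n * q < n * 2" using r n3 unfolding q[symmetric] by auto
    then have "0 < q" "q < 2" using n3 by (simp_all only: mult_less_cancel_left)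
    then have "q = 1" by linarith
    then have n2: "n = 2 * (r - 1)" using q by simp
    then have "odd r" using cop by (metis coprime_common_divisor dvd_triv_left odd_one)
    then have "r - 1 \<ge> 4" using r n3 n2 by presburger
    from stabilises_twin_steps[OF n2 this k] show ?thesis by simp
  next
    case 2
    have "r = 2" using 2 small[of "r - 2"] r by fastforce
    then have "odd n" using cop by simp
    then have "n \<ge> 5" using n3 by presburger
    then show ?thesis
      using affine_map_of_hom_1_2[OF _ \<open>odd n\<close>] all_affine \<open>r = 2\<close> by simp
  next
    case 3
    then have r2: "[2 * r = 1] (mod n)" by (simp add: cong_iff_dvd_diff)
    then have "coprime 2 n" using coprime_iff_invertible_int by blast
    then have "odd n" by simp
    then have n5: "n \<ge> 5" using n3 by presburger
    show ?thesis
    proof (rule all_affine)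
      fix h assume h: "cay_hom n 1 r h"
      from cay_hom_dilate[OF h r2] have "cay_hom n 2 (2 * r) (dilate 2 r h)" by simp
      from cay_hom_cong_steps[OF this _ r2] have "cay_hom n 2 1 (dilate 2 r h)" by simp
      from affine_map_of_hom_1_2[OF n5 \<open>odd n\<close> cay_hom_swap[OF this]]
      have "affine_map n (dilate 2 r h)" .
      moreover have "[r * 2 = 1] (mod n)" using r2 by (simp add: mult.commute)
      ultimately have "affine_map n (dilate r 2 (dilate 2 r h))"
        by (rule affine_map_dilate[rotated])
      then show "affine_map n h"
        by (rule affine_map_cong) (rule dilate_inverse[OF h \<open>[r * 2 = 1] (mod n)\<close>])
    qed
  next
    case 4
    have "\<not> n dvd r - 1" "\<not> n dvd r + 1" 
      using small[of "r - 1"] small[of "r + 1"] r by linarith+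
    from affine_or_closed_walk[OF n less_imp_le[OF r(1)] r' this 4(2,3,1)]
      show ?thesis using no d_half[OF 4(1)] by (intro all_affine) blast
  qed
qed

section \<open>Closed walks of length \<open>d\<close>\<close>

text \<open>
  The walk starts with \<open>u\<close> steps \<open>1\<close>, fills up the first \<open>l\<close> steps with \<open>r\<close>, and continues with the
  remaining \<open>x - u\<close> steps \<open>1\<close> followed by steps \<open>r\<close>. In the proof, \<open>ones j\<close> is the number of steps \<open>1\<close> among
  the first \<open>j\<close>, and \<open>c j\<close> is the position reached. The walk closes up after \<open>d\<close> steps, so it can be
  indexed by residues modulo \<open>d\<close>, where \<open>1\<close> and \<open>r\<close> agree.
\<close>

lemma hom_along_closed_walk:
  fixes n d r x y l u :: int
  assumes d: "d dvd n" "d dvd r - 1" "d > 0"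
    and xy: "x + y = d" "n dvd x + y * r"
    and u: "0 \<le> u" "u \<le> l" "u \<le> x" "l - u \<le> y"
  obtains w where "cay_hom n 1 r w" "w 0 = 0" "\<And>i. i mod d = l \<Longrightarrow> w i = u + (l - u) * r"
proof -
  define ones where "ones j = min j u + max 0 (min (j - l) (x - u))" for j
  define c where "c j = ones j + (j - ones j) * r" for j
  define w where "w i = c (i mod d)" for i
  have c_step: "c (j + 1) - c j \<in> {1, r}" for j
  proof -
    have "ones (j + 1) = ones j \<or> ones (j + 1) = ones j + 1"
      using u unfolding ones_def by linarith
    then show ?thesis by (auto simp: c_def algebra_simps)
  qed
  have c_0: "c 0 = 0" using u by (simp add: c_def ones_def)
  have "ones d = x" using u xy by (simp add: ones_def)
  moreover have "d - x = y" using xy by simp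
  ultimately have c_d: "n dvd c d" using xy by (simp only: c_def)
  have "cay_hom n 1 r w"
    unfolding cay_hom_def
  proof (intro conjI allI ballI impI)
    show "[w i = w j] (mod n)" if "[i = j] (mod n)" for i j
      using cong_dvd_modulus[OF that d(1)] by (simp add: w_def cong_def)
  next
    fix i e assume "e \<in> {1, r}"
    then have "[e = 1] (mod d)" using d(2) by (auto simp: cong_iff_dvd_diff)
    then have "[i + e = i mod d + 1] (mod d)" by (intro cong_add) auto
    then have idx: "(i + e) mod d = (i mod d + 1) mod d" by (simp add: cong_def)
    have j: "0 \<le> i mod d" "i mod d < d" using d(3) by simp_all
    have "[w (i + e) = c (i mod d + 1)] (mod n)"
    proof (cases "i mod d + 1 = d")
      case True
      then have "w (i + e) = 0" by (simp add: w_def idx c_0)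
      then show ?thesis using c_d True by (simp add: cong_iff_dvd_diff)
    next
      case False
      then show ?thesis using j by (simp add: w_def idx)
    qed
    then have "[w (i + e) - w i = c (i mod d + 1) - c (i mod d)] (mod n)"
      unfolding w_def by (intro cong_diff) auto
    then show "\<exists>e'\<in>{0, 1, r}. [w (i + e) - w i = e'] (mod n)"
      using c_step[of "i mod d"] by blast
  qed
  moreover have "w 0 = 0" by (simp add: w_def c_0)
  moreover have "w i = u + (l - u) * r" if "i mod d = l" for i
    using u that by (simp add: w_def c_def ones_def)
  ultimately show thesis by (rule that)
qed

text \<open>
  Compare the conjugate of the walk at \<open>0\<close> and \<open>1\<close>: the walk itself is evaluated at \<open>0\<close> and \<open>k'\<close>, that
  is, after \<open>k' mod d\<close> steps. The increment \<open>0\<close> is excluded because a sum of \<open>l\<close> steps is \<open>l\<close> modulo \<open>d\<close>, and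
  \<open>k'\<close> is a unit modulo \<open>d\<close>.
\<close>

lemma stabilises_imp_window_sum:
  fixes n d r x y l u :: int
  assumes stab: "stabilises n 1 r k k'" and k: "[k * k' = 1] (mod n)"
    and d: "d dvd n" "d dvd r - 1" "d \<ge> 2"
    and xy: "x + y = d" "n dvd x + y * r"
    and u: "0 \<le> u" "u \<le> k' mod d" "u \<le> x" "k' mod d - u \<le> y"
  shows "[k * (u + (k' mod d - u) * r) = 1] (mod n) \<or> [k * (u + (k' mod d - u) * r) = r] (mod n)"
proof -
  define l where "l = k' mod d"
  have "d > 0" using d by simp
  from hom_along_closed_walk[OF d(1,2) this xy u]
  obtain w where w: "cay_hom n 1 r w" "w 0 = 0"
    "\<And>i. i mod d = l \<Longrightarrow> w i = u + (l - u) * r" unfolding l_def by blast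
  have "cay_hom n 1 r (dilate k k' w)" using stab w(1) by (simp add: stabilises_def)
  from cay_hom_step[OF this, of 1 0]
  obtain e where e: "e \<in> {0, 1, r}" "[dilate k k' w 1 - dilate k k' w 0 = e] (mod n)" by auto
  have "dilate k k' w 1 - dilate k k' w 0 = k * (u + (l - u) * r)"
    using w(2) w(3)[of k'] by (simp add: dilate_def l_def)
  with e have e': "e \<in> {0, 1, r}" "[k * (u + (l - u) * r) = e] (mod n)" by simp_all
  have "e \<noteq> 0"
  proof
    assume "e = 0"
    with e' have *: "d dvd k * (u + (l - u) * r)" using d(1) dvd_trans by (auto simp: cong_0_iff)
    have **: "d dvd k * k' - 1" using k d(1) dvd_trans by (auto simp: cong_iff_dvd_diff)
    have "d dvd u + (l - u) * r"
      by (rule dvd_lincomb[OF * **, of _ k' "- (u + (l - u) * r)"]) (simp add: algebra_simps)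
    then have dl: "d dvd l"
      by (rule dvd_lincomb[OF _ d(2), of _ _ 1 "- (l - u)"]) (simp add: algebra_simps)
    have "d dvd k'" using dl by (simp add: l_def dvd_mod_iff)
    then have "d dvd k * k' - (k * k' - 1)" by (intro dvd_diff[OF _ **] dvd_mult)
    then show False using d(3) by simp
  qed
  then show ?thesis using e' by (auto simp: l_def)
qed

text \<open>
  A window of \<open>l\<close> consecutive steps may contain any number \<open>u\<close> of steps \<open>1\<close> between \<open>max 0 (l - y)\<close> and
  \<open>min l x\<close>, and increasing \<open>u\<close> by one adds \<open>k * (1 - r)\<close> to \<open>k\<close> times the window sum. The order of
  \<open>1 - r\<close> modulo \<open>n\<close> is \<open>n / d > 2\<close>, so three consecutive values of \<open>u\<close> would give three different elements
  of \<open>{1, r}\<close>. With \<open>x\<close> and \<open>y\<close> at least \<open>2\<close> this leaves only \<open>l = 1\<close> and \<open>l = d - 1\<close>.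
\<close>

lemma stabilising_unit_cases:
  fixes n r k k' x y d :: int
  assumes n: "n > 0" and stab: "stabilises n 1 r k k'" and k: "[k * k' = 1] (mod n)"
    and r: "[r * r' = 1] (mod n)" "\<not> n dvd r - 1"
    and d: "d = gcd n (1 - r)" "2 * d < n"
    and xy: "0 < x" "0 < y" "x + y = d" "n dvd x + y * r"
  shows "[k = 1] (mod n) \<or> [k = -1] (mod n) \<or>
    n dvd r * r - 1 \<and> ([k = r] (mod n) \<or> [k = - r] (mod n))"
proof -
  define l where "l = k' mod d"
  have d2: "d \<ge> 2" using xy by simp
  have dn: "d dvd n" and dr: "d dvd 1 - r" using d by simp_all
  then have dr': "d dvd r - 1" by (simp only: dvd_diff_commute)
  have l: "0 \<le> l" "l < d" using d2 by (simp_all add: l_def)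
  have kk': "n dvd k * k' - 1" using k by (simp add: cong_iff_dvd_diff)
  have cancel_k: "n dvd a" if "n dvd k * a" for a
    by (rule dvd_lincomb[OF that kk', of _ k' "- a"]) (simp add: algebra_simps)
  have cancel_r: "n dvd a" if "n dvd r * a" for a
  proof (rule dvd_lincomb[OF that])
    show "n dvd r * r' - 1" using r by (simp add: cong_iff_dvd_diff)
    show "a = r' * (r * a) + (- a) * (r * r' - 1)" by (simp add: algebra_simps)
  qed
  have l0: "l \<noteq> 0"
  proof
    assume "l = 0"
    then have "d dvd k * k'" unfolding l_def by (intro dvd_mult) presburger
    then have "d dvd k * k' - (k * k' - 1)" by (rule dvd_diff) (rule dvd_trans[OF dn kk'])
    then show False using d2 by simp
  qed
  have window: "n dvd k * (u + (l - u) * r) - 1 \<or> n dvd k * (u + (l - u) * r) - r"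
    if "x + y = d" "n dvd x + y * r" "0 \<le> u" "u \<le> l" "u \<le> x" "l - u \<le> y" for x y u
    using stabilises_imp_window_sum[OF stab k dn dr' d2 that(1,2,3)] that(4-6)
    by (simp add: l_def cong_iff_dvd_diff)
  have diff_ne: "\<not> n dvd k * (1 - r)" "\<not> n dvd 2 * (k * (1 - r))"
  proof -
    have "\<not> n dvd 2 * (1 - r)"
    proof
      assume "n dvd 2 * (1 - r)"
      then have "n dvd gcd (2 * n) (2 * (1 - r))" by (intro gcd_greatest) simp_all
      also have "gcd (2 * n) (2 * (1 - r)) = 2 * d" unfolding d(1) gcd_mult_left by simp
      finally show False using d(2) d2 zdvd_imp_le[of n "2 * d"] by simp
    qed
    then show "\<not> n dvd 2 * (k * (1 - r))" using cancel_k[of "2 * (1 - r)"] by (auto simp: ac_simps)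
    then show "\<not> n dvd k * (1 - r)" by auto
  qed
  have not_three: False
    if u: "x + y = d" "n dvd x + y * r" "0 \<le> u" "l - u \<le> y" "u + 2 \<le> l" "u + 2 \<le> x" for x y u
  proof -
    define A where "A = k * (u + (l - u) * r)"
    define z where "z = k * (1 - r)"
    have "n dvd A - 1 \<or> n dvd A - r"
      using window[OF u(1,2), of u] u by (simp add: A_def)
    moreover have "n dvd (A + z) - 1 \<or> n dvd (A + z) - r"
      using window[OF u(1,2), of "u + 1"] u by (simp add: A_def z_def algebra_simps)
    moreover have "n dvd (A + 2 * z) - 1 \<or> n dvd (A + 2 * z) - r"
      using window[OF u(1,2), of "u + 2"] u by (simp add: A_def z_def algebra_simps)
    ultimately obtain a b c where abc: "n dvd A - a" "n dvd A + z - b" "n dvd A + 2 * z - c"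
      "a = b \<or> b = c \<or> a = c" by blast
    have "n dvd z" if "a = b"
      by (rule dvd_lincomb[OF abc(1,2), of _ "-1" 1]) (simp add: that)
    moreover have "n dvd z" if "b = c"
      by (rule dvd_lincomb[OF abc(2,3), of _ "-1" 1]) (simp add: that)
    moreover have "n dvd 2 * z" if "a = c"
      by (rule dvd_lincomb[OF abc(1,3), of _ "-1" 1]) (simp add: that)
    ultimately show False using abc(4) diff_ne by (auto simp: z_def)
  qed
  have extremal: "l = 1 \<or> l = d - 1" if "2 \<le> x" "2 \<le> y" "x + y = d" "n dvd x + y * r" for x y
  proof (rule ccontr)
    assume "\<not> (l = 1 \<or> l = d - 1)"
    then have "2 \<le> l" "l \<le> d - 2" using l l0 by linarith+
    then show False
      using not_three[OF that(3,4), of "max 0 (l - y)"] that by linarith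
  qed
  \<comment> \<open>If \<open>x = 1\<close> or \<open>y = 1\<close>, put \<open>e = n / d\<close>. Shifting \<open>x\<close> by \<open>e\<close> gives another solution, since \<open>n\<close> divides
    \<open>e * (1 - r)\<close>. The two window sums show that \<open>k\<close> is \<open>1\<close> or \<open>-1\<close> modulo \<open>e\<close>, so \<open>e\<close> divides
    \<open>l - 1\<close> or \<open>d - 1 - l\<close>. Hence \<open>e \<le> d - 3\<close>, which leaves room for both numbers of the new solution
    to be at least \<open>2\<close>.\<close>
  have l_ends: "l = 1 \<or> l = d - 1"
  proof (rule ccontr)
    assume ends: "\<not> (l = 1 \<or> l = d - 1)"
    then have l': "2 \<le> l" "l \<le> d - 2" using l l0 by linarith+
    obtain e where e: "n = d * e" using dn by blast
    obtain w where w: "1 - r = d * w" using dr by blast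
    have "e > 0" using e n d2 by (simp add: zero_less_mult_iff)
    have e_w: "coprime e w"
    proof -
      have "d * gcd e w = d" using d(1) d2 by (simp add: e w gcd_mult_left)
      then show ?thesis using d2 by (simp add: coprime_iff_gcd_eq_1)
    qed
    have e_dvd: "e dvd a" if "n dvd a * (1 - r)" for a
    proof -
      have "d * e dvd d * (a * w)" using that by (simp add: e w ac_simps)
      then have "e dvd a * w" using d2 by simp
      then show ?thesis using e_w by (simp add: coprime_dvd_mult_left_iff)
    qed
    have en: "e dvd n" by (simp add: e)
    have n_e: "n dvd e * (1 - r)" by (simp add: e w)
    have "x = 1 \<or> y = 1" using extremal[OF _ _ xy(3,4)] xy ends by linarith
    then show False
    proof
      assume x1: "x = 1"
      have y: "y = d - 1" using xy x1 by simp
      have 0: "n dvd k * (l * r) - 1 \<or> n dvd k * (l * r) - r"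
        using window[OF xy(3,4), of 0] l' by (simp add: y x1)
      have 1: "n dvd k * (1 + (l - 1) * r) - 1 \<or> n dvd k * (1 + (l - 1) * r) - r"
        using window[OF xy(3,4), of 1] l' by (simp add: y x1)
      have new: "n dvd (1 + e) + (d - 1 - e) * r"
        by (rule dvd_lincomb[OF xy(4) n_e, of _ 1 1]) (simp add: x1 y algebra_simps)
      have "d - 1 - e \<le> 1"
        using extremal[OF _ _ _ new] \<open>e > 0\<close> ends by linarith
      moreover have "e \<le> d - 3"
      proof -
        consider "n dvd k * (l * r) - r" "n dvd k * (1 + (l - 1) * r) - 1"
          | "n dvd k * (l * r) - 1" "n dvd k * (1 + (l - 1) * r) - r"
          | a where "n dvd k * (l * r) - a" "n dvd k * (1 + (l - 1) * r) - a"
          using 0 1 by blast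
        then show ?thesis
        proof cases
          case 1
          have "n dvd r * (k * l - 1)" using 1(1) by (simp add: algebra_simps)
          then have kl: "n dvd k * l - 1" by (rule cancel_r)
          have "n dvd (k - 1) * (1 - r)"
            by (rule dvd_lincomb[OF 1, of _ "-1" 1]) (simp add: algebra_simps)
          then have ek: "e dvd k - 1" by (rule e_dvd)
          have "e dvd l - 1"
            by (rule dvd_lincomb[OF dvd_trans[OF en kl] ek, of _ 1 "- l"]) (simp add: algebra_simps)
          then show ?thesis using l' zdvd_imp_le[of e "l - 1"] by simp
        next
          case 2
          have "n dvd (k + 1) * (1 - r)"
            by (rule dvd_lincomb[OF 2, of _ "-1" 1]) (simp add: algebra_simps)
          then have ek: "e dvd k + 1" by (rule e_dvd)
          have "e dvd l * r + 1"
            by (rule dvd_lincomb[OF dvd_trans[OF en 2(1)] ek, of _ "-1" "l * r"])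
              (simp add: algebra_simps)
          moreover have "e dvd 1 + (d - 1) * r" using dvd_trans[OF en xy(4)] by (simp add: x1 y)
          ultimately have "e dvd (1 + (d - 1) * r) - (l * r + 1)" by (intro dvd_diff)
          then have "e dvd r * (d - 1 - l)" by (simp add: algebra_simps)
          moreover have "e dvd r * r' - 1" using dvd_trans[OF en] r(1) by (simp add: cong_iff_dvd_diff)
          ultimately have "e dvd d - 1 - l"
            by (rule dvd_lincomb[of _ _ _ _ r' "- (d - 1 - l)"]) (simp add: algebra_simps)
          then show ?thesis using l' zdvd_imp_le[of e "d - 1 - l"] by simp
        next
          case 3
          have "n dvd k * (1 - r)"
            by (rule dvd_lincomb[OF 3, of _ "-1" 1]) (simp add: algebra_simps)
          then show ?thesis using diff_ne by blast
        qed
      qed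
      ultimately show False by linarith
    next
      assume y1: "y = 1"
      have x: "x = d - 1" using xy y1 by simp
      have 0: "n dvd k * l - 1 \<or> n dvd k * l - r"
        using window[OF xy(3,4), of l] l' by (simp add: x y1)
      have 1: "n dvd k * (l - 1 + r) - 1 \<or> n dvd k * (l - 1 + r) - r"
        using window[OF xy(3,4), of "l - 1"] l' by (simp add: x y1)
      have new: "n dvd (d - 1 - e) + (1 + e) * r"
        by (rule dvd_lincomb[OF xy(4) n_e, of _ 1 "-1"]) (simp add: x y1 algebra_simps)
      have "d - 1 - e \<le> 1"
        using extremal[OF _ _ _ new] \<open>e > 0\<close> ends by linarith
      moreover have "e \<le> d - 3"
      proof -
        consider "n dvd k * l - 1" "n dvd k * (l - 1 + r) - r"
          | "n dvd k * l - r" "n dvd k * (l - 1 + r) - 1"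
          | a where "n dvd k * l - a" "n dvd k * (l - 1 + r) - a"
          using 0 1 by blast
        then show ?thesis
        proof cases
          case 1
          have "n dvd (k - 1) * (1 - r)"
            by (rule dvd_lincomb[OF 1, of _ 1 "-1"]) (simp add: algebra_simps)
          then have ek: "e dvd k - 1" by (rule e_dvd)
          have "e dvd l - 1"
            by (rule dvd_lincomb[OF dvd_trans[OF en 1(1)] ek, of _ 1 "- l"]) (simp add: algebra_simps)
          then show ?thesis using l' zdvd_imp_le[of e "l - 1"] by simp
        next
          case 2
          have "n dvd (k + 1) * (1 - r)"
            by (rule dvd_lincomb[OF 2, of _ 1 "-1"]) (simp add: algebra_simps)
          then have ek: "e dvd k + 1" by (rule e_dvd)
          have "e dvd l + r"
            by (rule dvd_lincomb[OF dvd_trans[OF en 2(1)] ek, of _ "-1" l]) (simp add: algebra_simps)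
          moreover have "e dvd d - 1 + r" using dvd_trans[OF en xy(4)] by (simp add: x y1)
          ultimately have "e dvd (d - 1 + r) - (l + r)" by (intro dvd_diff)
          then show ?thesis using l' zdvd_imp_le[of e "d - 1 - l"] by simp
        next
          case 3
          have "n dvd k * (1 - r)"
            by (rule dvd_lincomb[OF 3, of _ 1 "-1"]) (simp add: algebra_simps)
          then show ?thesis using diff_ne by blast
        qed
      qed
      ultimately show False by linarith
    qed
  qed
  \<comment> \<open>If multiplication by \<open>c\<close> maps \<open>{1, r}\<close> into itself, it is the identity or the swap.\<close>
  have key: "n dvd c - 1 \<or> n dvd r * r - 1 \<and> n dvd c - r"
    if c: "n dvd c - 1 \<or> n dvd c - r" "n dvd c * r - 1 \<or> n dvd c * r - r" for c
  proof (cases "n dvd c - 1")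
    case False
    then have cr: "n dvd c - r" using c by blast
    have "\<not> n dvd c * r - r"
    proof
      assume "n dvd c * r - r"
      then have "n dvd r * (c - 1)" by (simp add: algebra_simps)
      then show False using cancel_r False by blast
    qed
    then have "n dvd c * r - 1" using c by blast
    from dvd_lincomb[OF this cr, of "r * r - 1" 1 "- r"] cr show ?thesis
      by (simp add: algebra_simps)
  qed simp
  from l_ends show ?thesis
  proof
    assume "l = 1"
    then have "n dvd k * r - 1 \<or> n dvd k * r - r" "n dvd k - 1 \<or> n dvd k - r"
      using window[OF xy(3,4), of 0] window[OF xy(3,4), of 1] xy(1,2) by simp_all
    then show ?thesis using key[of k] by (auto simp: cong_iff_dvd_diff)
  next
    assume ld: "l = d - 1"
    then have l_xy: "l = x + y - 1" using xy(3) by simp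
    \<comment> \<open>A window of \<open>d - 1\<close> steps is the closed walk without one step, so its sum is \<open>-1\<close> or \<open>-r\<close>.\<close>
    have "n dvd (- k) * r - a" if "n dvd k * (x + (l - x) * r) - a" for a
      by (rule dvd_lincomb[OF that xy(4), of _ 1 "- k"])
        (simp add: l_xy algebra_simps)
    then have 1: "n dvd (- k) * r - 1 \<or> n dvd (- k) * r - r"
      using window[OF xy(3,4), of x] xy ld by auto
    have "n dvd (- k) - a" if "n dvd k * (x - 1 + (l - (x - 1)) * r) - a" for a
      by (rule dvd_lincomb[OF that xy(4), of _ 1 "- k"])
        (simp add: l_xy algebra_simps)
    then have 2: "n dvd (- k) - 1 \<or> n dvd (- k) - r"
      using window[OF xy(3,4), of "x - 1"] xy ld by auto
    have neg: "n dvd k - (- a)" if "n dvd - k - a" for a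
      using that by (subst dvd_minus_iff[symmetric]) simp
    show ?thesis using key[OF 2 1] neg[of 1] neg[of r] by (auto simp: cong_iff_dvd_diff)
  qed
qed

section \<open>The stabilising units\<close>

text \<open>
  Multiplication by such a \<open>k\<close> maps \<open>{0, 1, r}\<close> to itself or to its negative, and reversing all arcs does
  not change the endomorphisms.
\<close>

lemma stabilises_of_automorphism:
  assumes k: "[k * k' = 1] (mod n)"
    and cases: "[k = 1] (mod n) \<or> [k = -1] (mod n) \<or>
      n dvd r * r - 1 \<and> ([k = r] (mod n) \<or> [k = - r] (mod n))"
  shows "stabilises n 1 r k k'"
  unfolding stabilises_def
proof (intro allI impI)
  fix h assume "cay_hom n 1 r h"
  from cay_hom_dilate[OF this k] have dil: "cay_hom n k (k * r) (dilate k k' h)" by simp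
  consider "[k = 1] (mod n)" "[k * r = r] (mod n)"
    | "[k = -1] (mod n)" "[k * r = - r] (mod n)"
    | "[k = r] (mod n)" "[k * r = 1] (mod n)"
    | "[k = - r] (mod n)" "[k * r = -1] (mod n)"
  proof -
    have mult: "[k * r = a * r] (mod n)" if "[k = a] (mod n)" for a
      using that by (rule cong_scalar_right)
    have sq: "[r * r = 1] (mod n)" "[- r * r = - 1] (mod n)" if "n dvd r * r - 1"
      using that cong_uminus[of "r * r" 1 n] by (simp_all add: cong_iff_dvd_diff)
    show thesis
      using cases mult[of 1] mult[of "-1"] mult[of r] mult[of "- r"] sq that cong_trans
      by (metis mult_1 mult_minus1)
  qed
  then show "cay_hom n 1 r (dilate k k' h)"
  proof cases
    case 1
    with dil show ?thesis by (rule cay_hom_cong_steps)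
  next
    case 2
    from cay_hom_uminus[OF cay_hom_cong_steps[OF dil 2]] show ?thesis by simp
  next
    case 3
    from cay_hom_swap[OF cay_hom_cong_steps[OF dil 3]] show ?thesis .
  next
    case 4
    from cay_hom_swap[OF cay_hom_uminus[OF cay_hom_cong_steps[OF dil 4]]] show ?thesis by simp
  qed
qed

theorem theorem1p3:
  fixes n s t d :: int and R :: "int ring" and S :: "int set"
  assumes "n \<ge> 3"
    and "R = residue_ring n"
    and "s \<in> Units R" and "t \<in> Units R"
    and "t \<noteq> s" and "t \<noteq> \<ominus>\<^bsub>R\<^esub> s"
    and "S = {\<zero>\<^bsub>R\<^esub>, s, t}"
    and "d = gcd n (s - t)"
  shows
    "(2 * d < n \<and> (\<exists>x::int. 1 \<le> x \<and> x \<le> d - 1 \<and> [x * s + (d - x) * t = 0] (mod n)) \<longrightarrow>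
      U R S = (if [t\<^sup>2 = s\<^sup>2] (mod n)
        then {\<one>\<^bsub>R\<^esub>, \<ominus>\<^bsub>R\<^esub> \<one>\<^bsub>R\<^esub>, t \<otimes>\<^bsub>R\<^esub> inv\<^bsub>R\<^esub> s, \<ominus>\<^bsub>R\<^esub> (t \<otimes>\<^bsub>R\<^esub> inv\<^bsub>R\<^esub> s)}
        else {\<one>\<^bsub>R\<^esub>, \<ominus>\<^bsub>R\<^esub> \<one>\<^bsub>R\<^esub>})) \<and>
    (\<not> (2 * d < n \<and> (\<exists>x::int. 1 \<le> x \<and> x \<le> d - 1 \<and> [x * s + (d - x) * t = 0] (mod n))) \<longrightarrow>
      U R S = Units R)"
proof -
  interpret residues n R
  proof -
    show "residues n" using assms(1) by unfold_locales simp
    show "R \<equiv> residue_ring n" by (rule eq_reflection[OF assms(2)])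
  qed
  define r where "r = t \<otimes>\<^bsub>R\<^esub> inv\<^bsub>R\<^esub> s"
  have s: "0 < s" "s < n" "coprime s n" and t: "0 < t" "t < n"
    using assms(3,4) by (auto simp: res_units_eq)
  have r_unit: "r \<in> Units R" using assms(3,4) by (simp add: r_def)
  then have r: "0 < r" "r < n" "coprime r n" by (auto simp: res_units_eq)
  have ss': "[s * inv\<^bsub>R\<^esub> s = 1] (mod n)" by (rule inv_cong[OF assms(3)])
  have sr: "[s * r = t] (mod n)"
  proof -
    have "[s * r = s * (t * inv\<^bsub>R\<^esub> s)] (mod n)"
      by (simp add: r_def res_mult_eq cong_def mod_mult_right_eq)
    also have "s * (t * inv\<^bsub>R\<^esub> s) = (s * inv\<^bsub>R\<^esub> s) * t" by (simp add: ac_simps)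
    also have "[(s * inv\<^bsub>R\<^esub> s) * t = 1 * t] (mod n)" by (rule cong_scalar_right[OF ss'])
    finally show ?thesis by simp
  qed
  have r1: "r \<noteq> 1"
  proof
    assume "r = 1"
    then have "s = t" using sr s t by (simp add: cong_def)
    then show False using assms(5) by simp
  qed
  have r2: "r \<noteq> n - 1"
  proof
    assume "r = n - 1"
    then have "n dvd s * (n - 1) - t" using sr by (simp add: cong_iff_dvd_diff)
    then have "n dvd - (s * (n - 1) - t) + n * s" by (simp only: dvd_add_left_iff dvd_triv_left dvd_minus_iff)
    then have "[t = - s] (mod n)" by (simp add: cong_iff_dvd_diff algebra_simps)
    then have "t = \<ominus>\<^bsub>R\<^esub> s" using t by (simp add: cong_def res_neg_eq)
    then show False using assms(6) by simp
  qed
  have cancel_s: "n dvd s * a \<longleftrightarrow> n dvd a" for a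
    using s(3) by (simp add: coprime_dvd_mult_right_iff coprime_commute)
  have t_sr: "n dvd s * r - t" using sr by (simp add: cong_iff_dvd_diff)
  have d: "d = gcd n (1 - r)"
  proof -
    have "[s - t = s * (1 - r)] (mod n)"
      using t_sr by (simp add: cong_iff_dvd_diff algebra_simps)
    then have "gcd (s - t) n = gcd (s * (1 - r)) n" by (rule cong_gcd_eq)
    also have "\<dots> = gcd (1 - r) n" 
      using s(3) by (intro gcd_mult_left_left_cancel) (simp only: coprime_commute)
    finally show ?thesis by (simp add: assms(8) gcd.commute)
  qed
  \<comment> \<open>Division by the unit \<open>s\<close> turns the equation into the closed walk condition for \<open>{0, 1, r}\<close>.\<close>
  have solution_iff: "(\<exists>x. 1 \<le> x \<and> x \<le> d - 1 \<and> [x * s + (d - x) * t = 0] (mod n)) \<longleftrightarrow>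
      (\<exists>x y. 0 < x \<and> 0 < y \<and> x + y = d \<and> n dvd x + y * r)"
  proof -
    have "n dvd x * s + y * t \<longleftrightarrow> n dvd x + y * r" for x y
    proof -
      have "s * (x + y * r) = y * (s * r - t) + (x * s + y * t)" by (simp add: algebra_simps)
      then have "n dvd x * s + y * t \<longleftrightarrow> n dvd s * (x + y * r)"
        using t_sr by (simp only: dvd_add_right_iff dvd_mult)
      then show ?thesis by (simp only: cancel_s)
    qed
    then have "(\<exists>x. 1 \<le> x \<and> x \<le> d - 1 \<and> [x * s + (d - x) * t = 0] (mod n)) \<longleftrightarrow>
        (\<exists>x. 0 < x \<and> 0 < d - x \<and> n dvd x + (d - x) * r)"
      by (intro ex_cong1) (auto simp: cong_0_iff)
    also have "\<dots> \<longleftrightarrow> (\<exists>x y. 0 < x \<and> 0 < y \<and> x + y = d \<and> n dvd x + y * r)"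
      by (metis add_diff_cancel_left' add.commute diff_add_cancel)
    finally show ?thesis .
  qed
  have mem_U: "k \<in> U R S \<longleftrightarrow> k \<in> Units R \<and> stabilises n 1 r k (inv\<^bsub>R\<^esub> k)" for k
  proof -
    have "stabilises n s t k (inv\<^bsub>R\<^esub> k) \<longleftrightarrow> stabilises n (s * 1) (s * r) k (inv\<^bsub>R\<^esub> k)"
      using cong_sym[OF sr] by (intro stabilises_cong_steps) simp_all
    also have "\<dots> \<longleftrightarrow> stabilises n 1 r k (inv\<^bsub>R\<^esub> k)" by (rule stabilises_rescale_iff[OF ss'])
    finally show ?thesis
      using mem_U_iff_stabilises[of s t k] assms(3,4) by (simp add: assms(7) Units_closed)
  qed
  show ?thesis
  proof (intro conjI impI)
    assume "2 * d < n \<and> (\<exists>x. 1 \<le> x \<and> x \<le> d - 1 \<and> [x * s + (d - x) * t = 0] (mod n))"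
    then obtain x y where xy: "2 * d < n" "0 < x" "0 < y" "x + y = d" "n dvd x + y * r"
      unfolding solution_iff by blast
    have r': "[r * inv\<^bsub>R\<^esub> r = 1] (mod n)" by (rule inv_cong[OF r_unit])
    have "\<not> n dvd r - 1" using r r1 zdvd_not_zless[of "r - 1" n] by simp
    note forced = stabilising_unit_cases[OF _ _ _ r' this d xy]
    have char: "k \<in> U R S \<longleftrightarrow> k \<in> Units R \<and> ([k = 1] (mod n) \<or> [k = -1] (mod n) \<or>
        n dvd r * r - 1 \<and> ([k = r] (mod n) \<or> [k = - r] (mod n)))" for k
      unfolding mem_U
      using forced[of k "inv\<^bsub>R\<^esub> k"] stabilises_of_automorphism[of k "inv\<^bsub>R\<^esub> k" n r]
        inv_cong[of k] m_gt_one by auto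
    have unit_eq: "k \<in> Units R \<and> [k = c] (mod n) \<longleftrightarrow> k = c mod n" if "coprime c n" for k c
    proof -
      have "k \<in> Units R \<Longrightarrow> k mod n = k" by (simp add: res_units_eq)
      then show ?thesis
        using that mod_in_res_units[OF m_gt_one that] by (auto simp: cong_def)
    qed
    have mods: "1 mod n = \<one>\<^bsub>R\<^esub>" "- 1 mod n = \<ominus>\<^bsub>R\<^esub> \<one>\<^bsub>R\<^esub>" "r mod n = r" "- r mod n = \<ominus>\<^bsub>R\<^esub> r"
      using r m_gt_one by (simp_all add: res_one_eq res_neg_eq)
    have "n dvd r * r - 1 \<longleftrightarrow> [t\<^sup>2 = s\<^sup>2] (mod n)"
    proof -
      have "[t\<^sup>2 = (s * r)\<^sup>2] (mod n)" by (intro cong_pow cong_sym[OF sr])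
      then have "[t\<^sup>2 = s\<^sup>2] (mod n) \<longleftrightarrow> [(s * r)\<^sup>2 = s\<^sup>2] (mod n)" by (simp add: cong_def)
      also have "\<dots> \<longleftrightarrow> n dvd s * (s * (r * r - 1))"
        by (simp add: cong_iff_dvd_diff power2_eq_square algebra_simps)
      finally show ?thesis by (simp only: cancel_s)
    qed
    then have "k \<in> U R S \<longleftrightarrow> k \<in> (if [t\<^sup>2 = s\<^sup>2] (mod n)
        then {\<one>\<^bsub>R\<^esub>, \<ominus>\<^bsub>R\<^esub> \<one>\<^bsub>R\<^esub>, r, \<ominus>\<^bsub>R\<^esub> r} else {\<one>\<^bsub>R\<^esub>, \<ominus>\<^bsub>R\<^esub> \<one>\<^bsub>R\<^esub>})" for k
      unfolding char
      using unit_eq[of 1 k] unit_eq[of "-1" k] unit_eq[of r k] unit_eq[of "- r" k] r(3)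
      by (auto simp: mods)
    then show "U R S = (if [t\<^sup>2 = s\<^sup>2] (mod n)
        then {\<one>\<^bsub>R\<^esub>, \<ominus>\<^bsub>R\<^esub> \<one>\<^bsub>R\<^esub>, t \<otimes>\<^bsub>R\<^esub> inv\<^bsub>R\<^esub> s, \<ominus>\<^bsub>R\<^esub> (t \<otimes>\<^bsub>R\<^esub> inv\<^bsub>R\<^esub> s)}
        else {\<one>\<^bsub>R\<^esub>, \<ominus>\<^bsub>R\<^esub> \<one>\<^bsub>R\<^esub>})"
      unfolding r_def[symmetric] by blast
  next
    assume no: "\<not> (2 * d < n \<and> (\<exists>x. 1 \<le> x \<and> x \<le> d - 1 \<and> [x * s + (d - x) * t = 0] (mod n)))"
    have no': "\<not> (2 * gcd n (1 - r) < n \<and>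
        (\<exists>x y. 0 < x \<and> 0 < y \<and> x + y = gcd n (1 - r) \<and> n dvd x + y * r))"
      using no unfolding solution_iff unfolding d .
    have "k \<in> U R S" if "k \<in> Units R" for k
      using that no' unfolding mem_U
      by (intro conjI stabilises_of_no_closed_walk assms(1) r r1 r2 inv_cong)
    then show "U R S = Units R" using mem_U by blast
  qed
qed

end
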